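(* If $G$ is a graph with $n$ vertices and $n\ge 14$, then $\varphi(G)\le n^2/4-n/2-1$.
   Context: Graphs are finite and simple. Two sets overlap if they intersect but neither contains the other. An overlap representation of a graph $G$ is an assignment $f$ of sets to the vertices of $G$ such that, for distinct vertices $u,v$, $uv\in E(G)$ if and only if $f(u)$ and $f(v)$ overlap. When the assigned sets are finite, the size of $f$ is $\left|\bigcup_{v\in V(G)} f(v)\right|$. The overlap number $\varphi(G)$ is the minimum size of an overlap representation of $G$ by finite sets. *)

theory Defs
  imports Complex_Main "Graph_Theory.Pair_Digraph"
begin

text \<open>
  Finite simple graphs are values satisfying \<^const>\<open>pair_graph\<close>: finite, symmetric and loop-free,
  with each undirected edge stored as its two ordered pairs.
\<close>

definition overlap :: "'b set \<Rightarrow> 'b set \<Rightarrow> bool" where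
  "overlap A B \<longleftrightarrow> A \<inter> B \<noteq> {} \<and> \<not> A \<subseteq> B \<and> \<not> B \<subseteq> A"

definition overlap_representation :: "'a pair_pre_digraph \<Rightarrow> ('a \<Rightarrow> 'b set) \<Rightarrow> bool" where
  "overlap_representation G f \<longleftrightarrow>
     (\<forall>u \<in> pverts G. \<forall>v \<in> pverts G. u \<noteq> v \<longrightarrow>
        ((u, v) \<in> parcs G \<longleftrightarrow> overlap (f u) (f v)))"

definition finite_overlap_representation :: "'a pair_pre_digraph \<Rightarrow> ('a \<Rightarrow> 'b set) \<Rightarrow> bool" where
  "finite_overlap_representation G f \<longleftrightarrow>
     overlap_representation G f \<and> (\<forall>v \<in> pverts G. finite (f v))"

definition representation_size :: "'a pair_pre_digraph \<Rightarrow> ('a \<Rightarrow> 'b set) \<Rightarrow> nat" where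
  "representation_size G f = card (\<Union>v \<in> pverts G. f v)"

text \<open>
  The ground set is taken to be a set of natural numbers. The lemmas below show that this loses
  nothing, representations over any other type being no smaller, and that the minimum is attained.
\<close>

definition overlap_number :: "'a pair_pre_digraph \<Rightarrow> nat" where
  "overlap_number G =
     (LEAST k. \<exists>f :: 'a \<Rightarrow> nat set.
        finite_overlap_representation G f \<and> representation_size G f = k)"

lemma overlap_image_iff:
  assumes "inj_on h U" "A \<subseteq> U" "B \<subseteq> U"
  shows "overlap (h ` A) (h ` B) \<longleftrightarrow> overlap A B"
proof -
  have "h ` A \<inter> h ` B = h ` (A \<inter> B)"
    using inj_on_image_Int[OF assms] by simp
  moreover have "h ` X \<subseteq> h ` Y \<longleftrightarrow> X \<subseteq> Y" if "X \<subseteq> U" "Y \<subseteq> U" for X Y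
    using inj_on_image_mem_iff[OF assms(1) _ that(2)] that(1) by blast
  ultimately show ?thesis
    using assms(2,3) unfolding overlap_def by simp
qed

lemma nat_representation_of_representation:
  fixes f :: "'a \<Rightarrow> 'b set"
  assumes fin: "finite (pverts G)" and f: "finite_overlap_representation G f"
  obtains g :: "'a \<Rightarrow> nat set"
  where "finite_overlap_representation G g" "representation_size G g = representation_size G f"
proof -
  let ?U = "\<Union>v \<in> pverts G. f v"
  have "finite ?U"
    using fin f unfolding finite_overlap_representation_def by blast
  from finite_imp_inj_to_nat_seg[OF this]
  obtain h :: "'b \<Rightarrow> nat" where h: "inj_on h ?U"
    by (elim exE conjE)
  define g where "g v = h ` f v" for v
  have ov: "overlap (g u) (g v) \<longleftrightarrow> overlap (f u) (f v)"
    if "u \<in> pverts G" "v \<in> pverts G" for u v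
    unfolding g_def using that by (intro overlap_image_iff[OF h]) auto
  have "finite_overlap_representation G g"
    using f ov unfolding finite_overlap_representation_def overlap_representation_def
    by (auto simp: g_def)
  moreover have "(\<Union>v \<in> pverts G. g v) = h ` ?U"
    by (auto simp: g_def)
  then have "representation_size G g = representation_size G f"
    unfolding representation_size_def using card_image[OF h] by simp
  ultimately show thesis by (rule that)
qed

lemma overlap_number_le:
  fixes f :: "'a \<Rightarrow> 'b set"
  assumes "finite (pverts G)" "finite_overlap_representation G f"
  shows "overlap_number G \<le> representation_size G f"
proof -
  obtain g :: "'a \<Rightarrow> nat set"
    where "finite_overlap_representation G g" "representation_size G g = representation_size G f"
    using nat_representation_of_representation[OF assms] .
  then show ?thesis
    unfolding overlap_number_def by (intro Least_le exI[of _ g] conjI)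
qed

lemma (in pair_graph) finite_overlap_representation_exists:
  "\<exists>f :: 'a \<Rightarrow> 'a set set. finite_overlap_representation G f"
proof -
  define f :: "'a \<Rightarrow> 'a set set" where
    "f v = insert {v} {{v, w} |w. (v, w) \<in> parcs G}" for v
  have sym: "(v, u) \<in> parcs G" if "(u, v) \<in> parcs G" for u v
    using that pair_sym_arcs by (auto simp: symmetric_def sym_def)
  have loop: "(v, v) \<notin> parcs G" for v
    using pair_no_loops by force
  have own: "{u} \<in> f u" "{u} \<notin> f v" if "u \<noteq> v" for u v
    using that by (auto simp: f_def)
  have "overlap (f u) (f v) \<longleftrightarrow> f u \<inter> f v \<noteq> {}" if "u \<noteq> v" for u v
    using own[of u v] own[of v u] that unfolding overlap_def by auto
  moreover have "f u \<inter> f v \<noteq> {} \<longleftrightarrow> (u, v) \<in> parcs G" if "u \<noteq> v" for u v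
  proof
    assume "f u \<inter> f v \<noteq> {}"
    then show "(u, v) \<in> parcs G"
      using that loop sym by (auto simp: f_def doubleton_eq_iff)
  next
    assume "(u, v) \<in> parcs G"
    then have "{u, v} \<in> f u" "{u, v} \<in> f v"
      using sym by (auto simp: f_def)
    then show "f u \<inter> f v \<noteq> {}" by blast
  qed
  moreover have "finite (f v)" for v
  proof -
    have "{{v, w} |w. (v, w) \<in> parcs G} \<subseteq> (\<lambda>e. {fst e, snd e}) ` parcs G"
      by force
    then show ?thesis
      unfolding f_def using finite_subset pair_finite_arcs by fastforce
  qed
  ultimately have "finite_overlap_representation G f"
    unfolding finite_overlap_representation_def overlap_representation_def by simp
  then show ?thesis by blast
qed

lemma (in pair_graph) overlap_number_attained:
  "\<exists>f :: 'a \<Rightarrow> nat set.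
     finite_overlap_representation G f \<and> representation_size G f = overlap_number G"
proof -
  obtain f :: "'a \<Rightarrow> 'a set set" where "finite_overlap_representation G f"
    using finite_overlap_representation_exists by blast
  then obtain g :: "'a \<Rightarrow> nat set" where "finite_overlap_representation G g"
    using nat_representation_of_representation[OF pair_finite_verts] by blast
  then have "\<exists>k. \<exists>f :: 'a \<Rightarrow> nat set.
      finite_overlap_representation G f \<and> representation_size G f = k"
    by blast
  from LeastI_ex[OF this] show ?thesis
    unfolding overlap_number_def .
qed

end

theory Submission
  imports Defs
begin

text \<open>
  In an overlap representation non-adjacent vertices may receive nested sets, and this is what saves
  about $n/2$ labels against the $n^2/4$ of the Erdos--Goodman--Posa clique cover. Three devices
  exploit nesting.

  \<^item> Non-adjacent vertices with equal neighbourhoods can share their set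
    (\<open>representable_of_twins\<close>).
  \<^item> All vertices of a clique \<open>Q\<close> can receive almost everything: every label that a clique cover of the
    rest uses, together with a private label of each vertex that they are \<^emph>\<open>not\<close> adjacent to. A
    non-neighbour is then nested in such a big set, and a neighbour sticks out by its private label.
    The edges within \<open>Q\<close> and between \<open>Q\<close> and the rest cost one label for each outside vertex, plus
    a few that separate the big sets from each other (\<open>representable_big_clique\<close>).
  \<^item> If the neighbourhood of \<open>u\<close> lies in that of a non-neighbour \<open>v\<close>, then the set of \<open>u\<close> can be
    nested in that of \<open>v\<close> and \<open>u\<close> costs essentially nothing (\<open>representable_nested\<close>).

  Suppose that the graph is triangle-free. If no vertex is dominated as in the third item, then any
  two adjacent vertices have degree sum at most $n-2$, so there are at most $n(n-2)/4$ edges, and taking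
  a single edge for \<open>Q\<close> saves one label (\<open>small_if_undominated\<close>). If \<open>v\<close> dominates \<open>u\<close>, then \<open>u\<close> is
  nested, and the bound can fail only if the rest has so many edges that it is a complete bipartite graph
  with at most two edges missing. In that case there are at most nine classes of twins, and one vertex
  of each suffices (\<open>small_if_dominated\<close>).

  Suppose that there is a triangle. A clique on four vertices, two disjoint triangles, or a triangle
  and a pair of twins leave so much room that the second item with a clique cover of the rest is
  enough, after dropping one of the twins in the last case. Otherwise the graph outside any triangle \<open>Q\<close> is triangle-free, and the second item with the
  edges as the cliques works unless that outside is again almost complete bipartite. Since there are no
  twins, vertices of one side that miss nothing on the other side all look different from \<open>Q\<close>. This
  produces another triangle, with one vertex in \<open>Q\<close> and one on each side, outside of which there are
  fewer edges (\<open>small_if_triangle\<close>).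
\<close>

section \<open>Graphs as adjacency relations\<close>

text \<open>
  One label type serves all constructions below. A \<open>Clique\<close> label is put on the
  vertices of a clique and makes them intersect; \<open>Own v\<close> is a private label of
  \<open>v\<close> among small sets, seen from the big sets as the part of \<open>v\<close> that
  they may miss; \<open>Mark\<close> labels separate the big sets from each other or tie a nested
  set to the one around it.
\<close>

datatype 'a label = Clique "'a set" | Own 'a | Mark "'a set"

text \<open>
  All recursion is on induced subgraphs, so the adjacency relation is fixed once and the vertex
  set is a parameter of every notion.
\<close>

locale simple_graph =
  fixes adj :: "'a \<Rightarrow> 'a \<Rightarrow> bool"
  assumes adj_sym: "adj u v \<Longrightarrow> adj v u"
    and adj_irrefl: "\<not> adj v v"
begin

lemma adj_commute: "adj u v \<longleftrightarrow> adj v u"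
  using adj_sym by blast

lemma adj_neq: "adj u v \<Longrightarrow> u \<noteq> v"
  using adj_irrefl by blast

definition nbrs :: "'a set \<Rightarrow> 'a \<Rightarrow> 'a set" where
  "nbrs S v = {u \<in> S. adj v u}"

definition deg :: "'a set \<Rightarrow> 'a \<Rightarrow> nat" where
  "deg S v = card (nbrs S v)"

definition edges :: "'a set \<Rightarrow> 'a set set" where
  "edges S = {{u, v} |u v. u \<in> S \<and> v \<in> S \<and> adj u v}"

definition clique :: "'a set \<Rightarrow> bool" where
  "clique Q \<longleftrightarrow> (\<forall>u \<in> Q. \<forall>v \<in> Q. u \<noteq> v \<longrightarrow> adj u v)"

definition triangle_free :: "'a set \<Rightarrow> bool" where
  "triangle_free S \<longleftrightarrow>
     (\<forall>a \<in> S. \<forall>b \<in> S. \<forall>c \<in> S. \<not> (adj a b \<and> adj b c \<and> adj a c))"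

definition clique_cover :: "'a set \<Rightarrow> 'a set set \<Rightarrow> bool" where
  "clique_cover S C \<longleftrightarrow> finite C \<and> (\<forall>c \<in> C. c \<subseteq> S \<and> clique c) \<and>
     (\<forall>u \<in> S. \<forall>v \<in> S. adj u v \<longrightarrow> (\<exists>c \<in> C. u \<in> c \<and> v \<in> c))"

definition representable :: "'a set \<Rightarrow> nat \<Rightarrow> bool" where
  "representable S k \<longleftrightarrow> (\<exists>f :: 'a \<Rightarrow> 'a label set.
     (\<forall>v \<in> S. finite (f v)) \<and>
     (\<forall>u \<in> S. \<forall>v \<in> S. u \<noteq> v \<longrightarrow> (adj u v \<longleftrightarrow> overlap (f u) (f v))) \<and>
     card (\<Union>v \<in> S. f v) \<le> k)"

text \<open>
  A set that consists of the labels of the edges at a vertex is not contained in that of a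
  neighbour as soon as the vertex has a second neighbour. The vertices of degree at most one are
  those that need an extra label.
\<close>

definition low :: "'a set \<Rightarrow> 'a set" where
  "low S = {v \<in> S. deg S v \<le> 1}"

text \<open>
  The edges as a clique cover. Isolated vertices are added as singletons because the big sets must
  intersect the set of every vertex.
\<close>

definition ecover :: "'a set \<Rightarrow> 'a set set" where
  "ecover S = edges S \<union> {{v} |v. v \<in> S \<and> nbrs S v = {}}"

lemma finite_nbrs [simp]: "finite S \<Longrightarrow> finite (nbrs S v)"
  by (simp add: nbrs_def)

lemma edges_subset_Pow: "edges S \<subseteq> Pow S"
  by (auto simp: edges_def)

lemma finite_edges [simp]: "finite S \<Longrightarrow> finite (edges S)"
  using finite_subset[OF edges_subset_Pow] by simp

lemma doubleton_in_edges: "{u, v} \<in> edges S \<longleftrightarrow> u \<in> S \<and> v \<in> S \<and> adj u v"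
  unfolding edges_def using adj_commute by (auto simp: doubleton_eq_iff)

lemma edges_mono: "S \<subseteq> T \<Longrightarrow> edges S \<subseteq> edges T"
  by (auto simp: edges_def)

section \<open>Constructions of overlap representations\<close>

lemma representableI:
  fixes f :: "'a \<Rightarrow> 'a label set"
  assumes "finite U" "card U \<le> k" "\<And>v. v \<in> S \<Longrightarrow> f v \<subseteq> U"
    and "\<And>u v. u \<in> S \<Longrightarrow> v \<in> S \<Longrightarrow> u \<noteq> v \<Longrightarrow> adj u v \<longleftrightarrow> overlap (f u) (f v)"
  shows "representable S k"
proof -
  have "card (\<Union>v \<in> S. f v) \<le> card U"
    using assms(1,3) by (intro card_mono) auto
  moreover have "\<forall>v \<in> S. finite (f v)"
    using assms(1,3) finite_subset by blast
  ultimately show ?thesis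
    unfolding representable_def using assms(2,4) by (intro exI[of _ f]) auto
qed

lemma representable_mono: "representable S k \<Longrightarrow> k \<le> l \<Longrightarrow> representable S l"
  unfolding representable_def by (elim exE conjE, intro exI conjI) auto

lemma overlap_sym: "overlap A B \<longleftrightarrow> overlap B A"
  by (auto simp: overlap_def)

lemma representable_of_twins:
  assumes finT: "finite T" and sub: "T \<subseteq> S"
    and twin: "\<And>v. v \<in> S \<Longrightarrow> \<exists>w \<in> T. nbrs S w = nbrs S v"
    and rep: "representable T k"
  shows "representable S k"
proof -
  obtain f :: "'a \<Rightarrow> 'a label set"
    where fin: "\<forall>v \<in> T. finite (f v)"
      and ov: "\<forall>u \<in> T. \<forall>v \<in> T. u \<noteq> v \<longrightarrow> (adj u v \<longleftrightarrow> overlap (f u) (f v))"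
      and size: "card (\<Union>v \<in> T. f v) \<le> k"
    using rep unfolding representable_def by blast
  obtain r where r: "\<And>v. v \<in> S \<Longrightarrow> r v \<in> T \<and> nbrs S (r v) = nbrs S v"
    using twin by metis
  have adj_r: "adj (r v) w \<longleftrightarrow> adj v w" if "v \<in> S" "w \<in> S" for v w
    using r[OF that(1)] that(2) unfolding nbrs_def by blast
  have "adj u v \<longleftrightarrow> overlap (f (r u)) (f (r v))" if uv: "u \<in> S" "v \<in> S" for u v
  proof -
    have "adj u v \<longleftrightarrow> adj (r u) (r v)"
      using adj_r adj_commute uv r sub by (metis subsetD)
    moreover have "\<not> adj w w \<and> \<not> overlap (f w) (f w)" for w
      by (simp add: adj_irrefl overlap_def)
    ultimately show ?thesis
      using ov r uv by metis
  qed
  moreover have "card (\<Union>v \<in> S. f (r v)) \<le> k"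
  proof -
    have "card (\<Union>v \<in> S. f (r v)) \<le> card (\<Union>v \<in> T. f v)"
      using fin r finT by (intro card_mono) auto
    then show ?thesis using size by simp
  qed
  ultimately show ?thesis
    unfolding representable_def using fin r by (intro exI[of _ "\<lambda>v. f (r v)"]) auto
qed

text \<open>
  The sets of \<open>H = S - Q\<close> consist of the cliques through a vertex and, for vertices
  in \<open>D\<close>, the private label. The set of \<open>q \<in> Q\<close> contains every
  clique label and the private labels of its non-neighbours. So the sets of its non-neighbours lie
  inside it, while a neighbour meets it in a clique label and leaves it by the private label. The
  remaining hypotheses say that nothing is nested by accident: \<open>own\<close> for adjacent
  vertices of \<open>H\<close>, \<open>sep\<close> for two vertices of \<open>Q\<close> (a
  neighbour of \<open>q\<close> that is not one of \<open>p\<close> has its private label in the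
  set of \<open>p\<close> only), and \<open>big\<close> for a vertex of \<open>Q\<close> and its
  neighbour.
\<close>

lemma representable_big_clique:
  assumes fin: "finite S" and Q: "Q \<subseteq> S" "clique Q"
    and C: "clique_cover (S - Q) C" "\<Union>C = S - Q"
    and ne: "Q \<noteq> {} \<Longrightarrow> C \<noteq> {}"
    and D: "D \<subseteq> S - Q" and R: "finite R"
    and touched: "\<And>v q. v \<in> S - Q \<Longrightarrow> q \<in> Q \<Longrightarrow> adj q v \<Longrightarrow> v \<in> D"
    and own: "\<And>v w. v \<in> S - Q - D \<Longrightarrow> w \<in> S - Q \<Longrightarrow> adj v w \<Longrightarrow> \<exists>c \<in> C. v \<in> c \<and> w \<notin> c"
    and sep: "\<And>p q. p \<in> Q \<Longrightarrow> q \<in> Q \<Longrightarrow> p \<noteq> q \<Longrightarrow>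
                (\<exists>r \<in> R. p \<in> r \<and> q \<notin> r) \<or> (\<exists>v \<in> D. adj q v \<and> \<not> adj p v)"
    and big: "\<And>v q. v \<in> S - Q \<Longrightarrow> q \<in> Q \<Longrightarrow> adj q v \<Longrightarrow>
                (\<exists>c \<in> C. v \<notin> c) \<or> (\<exists>w \<in> D. w \<noteq> v \<and> \<not> adj q w)"
  shows "representable S (card C + card D + card R)"
proof (rule representableI)
  define U where "U = Clique ` C \<union> Own ` D \<union> Mark ` R"
  define f where "f v = (if v \<in> Q
      then Clique ` C \<union> {Own w |w. w \<in> D \<and> \<not> adj v w} \<union> {Mark r |r. r \<in> R \<and> v \<in> r}
      else {Clique c |c. c \<in> C \<and> v \<in> c} \<union> (if v \<in> D then {Own v} else {}))" for v
  have finC: "finite C" and finD: "finite D"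
    using C(1) D fin finite_subset unfolding clique_cover_def by auto
  show "finite U" using finC finD R by (simp add: U_def)
  have "card U \<le> card (Clique ` C \<union> Own ` D) + card (Mark ` R)"
    unfolding U_def by (rule card_Un_le)
  also have "\<dots> \<le> card (Clique ` C) + card (Own ` D) + card (Mark ` R)"
    using card_Un_le by simp
  also have "\<dots> \<le> card C + card D + card R"
    using card_image_le[OF finC] card_image_le[OF finD] card_image_le[OF R] by (intro add_mono)
  finally show "card U \<le> card C + card D + card R" .
  show "f v \<subseteq> U" if "v \<in> S" for v
    by (auto simp: f_def U_def)
  have inC: "\<exists>c \<in> C. v \<in> c" if "v \<in> S - Q" for v
    using C(2) that by blast
  have HH: "adj u v \<longleftrightarrow> overlap (f u) (f v)" if uv: "u \<in> S - Q" "v \<in> S - Q" "u \<noteq> v" for u v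
  proof
    assume a: "adj u v"
    have not_sub: "\<not> f p \<subseteq> f q" if pq: "p \<in> S - Q" "q \<in> S - Q" "adj p q" for p q
    proof (cases "p \<in> D")
      case True
      then have "Own p \<in> f p - f q" using pq adj_neq by (auto simp: f_def)
      then show ?thesis by blast
    next
      case False
      then obtain c where "c \<in> C" "p \<in> c" "q \<notin> c" using own[of p q] pq by blast
      then have "Clique c \<in> f p - f q" using pq by (auto simp: f_def)
      then show ?thesis by blast
    qed
    obtain c where "c \<in> C" "u \<in> c" "v \<in> c"
      using C(1) uv a unfolding clique_cover_def by blast
    then have "Clique c \<in> f u \<inter> f v" using uv by (auto simp: f_def)
    then show "overlap (f u) (f v)"
      unfolding overlap_def using not_sub uv a adj_sym by blast
  next
    assume "overlap (f u) (f v)"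
    then obtain x where "x \<in> f u" "x \<in> f v" unfolding overlap_def by blast
    then obtain c where "c \<in> C" "u \<in> c" "v \<in> c"
      using uv by (auto simp: f_def split: if_splits)
    then show "adj u v" using C(1) uv(3) unfolding clique_cover_def clique_def by blast
  qed
  have QH: "adj q v \<longleftrightarrow> overlap (f q) (f v)" if qv: "q \<in> Q" "v \<in> S - Q" for q v
  proof
    assume a: "adj q v"
    then have vD: "v \<in> D" using touched qv by blast
    obtain c where "c \<in> C" "v \<in> c" using inC qv by blast
    then have "Clique c \<in> f q \<inter> f v" using qv by (auto simp: f_def)
    moreover have "Own v \<in> f v - f q" using a vD qv by (auto simp: f_def)
    moreover have "\<not> f q \<subseteq> f v"
      using big[OF qv(2,1) a]
    proof
      assume "\<exists>c \<in> C. v \<notin> c"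
      then obtain c where "c \<in> C" "v \<notin> c" by blast
      then have "Clique c \<in> f q - f v" using qv vD by (auto simp: f_def)
      then show ?thesis by blast
    next
      assume "\<exists>w \<in> D. w \<noteq> v \<and> \<not> adj q w"
      then obtain w where "w \<in> D" "w \<noteq> v" "\<not> adj q w" by blast
      then have "Own w \<in> f q - f v" using qv vD by (auto simp: f_def)
      then show ?thesis by blast
    qed
    ultimately show "overlap (f q) (f v)" unfolding overlap_def by blast
  next
    assume o: "overlap (f q) (f v)"
    show "adj q v"
    proof (rule ccontr)
      assume "\<not> adj q v"
      then have "f v \<subseteq> f q" using qv by (auto simp: f_def)
      then show False using o by (simp add: overlap_def)
    qed
  qed
  have QQ: "overlap (f p) (f q)" if pq: "p \<in> Q" "q \<in> Q" "p \<noteq> q" for p q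
  proof -
    have not_sub: "\<not> f p \<subseteq> f q" if "p \<in> Q" "q \<in> Q" "p \<noteq> q" for p q
      using sep[OF that]
    proof
      assume "\<exists>r \<in> R. p \<in> r \<and> q \<notin> r"
      then obtain r where "r \<in> R" "p \<in> r" "q \<notin> r" by blast
      then have "Mark r \<in> f p - f q" using that by (auto simp: f_def)
      then show ?thesis by blast
    next
      assume "\<exists>v \<in> D. adj q v \<and> \<not> adj p v"
      then obtain v where "v \<in> D" "adj q v" "\<not> adj p v" by blast
      then have "Own v \<in> f p - f q" using that by (auto simp: f_def)
      then show ?thesis by blast
    qed
    obtain c where "c \<in> C" using ne pq by blast
    then have "Clique c \<in> f p \<inter> f q" using pq by (auto simp: f_def)
    then show ?thesis unfolding overlap_def using not_sub[of p q] not_sub[of q p] pq by auto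
  qed
  show "adj u v \<longleftrightarrow> overlap (f u) (f v)" if "u \<in> S" "v \<in> S" "u \<noteq> v" for u v
  proof (cases "u \<in> Q")
    case True
    then show ?thesis
      using QH QQ that Q(2) unfolding clique_def by (cases "v \<in> Q") auto
  next
    case False
    show ?thesis
    proof (cases "v \<in> Q")
      case True
      then show ?thesis using QH[of v u] that False adj_commute overlap_sym by blast
    next
      case F: False
      then show ?thesis using HH that False by blast
    qed
  qed
qed

lemma not_low_obtains:
  assumes "finite S" "v \<in> S" "v \<notin> low S"
  obtains w where "w \<in> S" "adj v w" "w \<noteq> x"
proof -
  have "\<not> nbrs S v \<subseteq> {x}"
  proof
    assume "nbrs S v \<subseteq> {x}"
    then have "card (nbrs S v) \<le> card {x}" by (intro card_mono) auto
    then show False using assms unfolding low_def deg_def by simp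
  qed
  then show thesis using that unfolding nbrs_def by blast
qed

lemma clique_cover_ecover:
  assumes "finite S"
  shows "clique_cover S (ecover S)" "\<Union>(ecover S) = S"
proof -
  have "finite {{v} |v. v \<in> S \<and> nbrs S v = {}}"
    using assms by (auto intro: finite_subset[of _ "Pow S"])
  then have "finite (ecover S)"
    using assms unfolding ecover_def by simp
  moreover have "clique c" "c \<subseteq> S" if "c \<in> ecover S" for c
    using that adj_sym unfolding ecover_def edges_def clique_def by auto
  moreover have "{u, v} \<in> ecover S" if "u \<in> S" "v \<in> S" "adj u v" for u v
    using that unfolding ecover_def by (auto simp: doubleton_in_edges)
  ultimately show "clique_cover S (ecover S)"
    unfolding clique_cover_def by (metis insertCI)
  show "\<Union>(ecover S) = S"
  proof (rule equalityI)
    show "\<Union>(ecover S) \<subseteq> S" by (auto simp: ecover_def edges_def)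
    show "S \<subseteq> \<Union>(ecover S)"
    proof
      fix v assume v: "v \<in> S"
      show "v \<in> \<Union>(ecover S)"
      proof (cases "nbrs S v = {}")
        case True
        then show ?thesis using v unfolding ecover_def by blast
      next
        case False
        then obtain w where "w \<in> S" "adj v w" by (auto simp: nbrs_def)
        then have "{v, w} \<in> ecover S" using v by (simp add: ecover_def doubleton_in_edges)
        then show ?thesis by blast
      qed
    qed
  qed
qed

text \<open>
  The case \<open>Q = {}\<close>: the representation by edges, with private labels for vertices of
  low degree. It costs too much in general but is sufficient for sparse graphs.
\<close>

lemma representable_ecover:
  assumes fin: "finite S"
  shows "representable S (card (ecover S) + card (low S))"
proof -
  have "representable S (card (ecover S) + card (low S) + card ({} :: 'a set set))"
  proof (rule representable_big_clique[where Q = "{}"])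
    show "\<exists>c \<in> ecover S. v \<in> c \<and> w \<notin> c"
      if "v \<in> S - {} - low S" "w \<in> S - {}" "adj v w" for v w
    proof -
      obtain x where x: "x \<in> S" "adj v x" "x \<noteq> w"
        using not_low_obtains[of S v w] fin \<open>v \<in> S - {} - low S\<close> by auto
      then have "{v, x} \<in> ecover S"
        using that unfolding ecover_def by (auto simp: doubleton_in_edges)
      then show ?thesis
        using x adj_neq[OF \<open>adj v w\<close>] by (intro bexI[of _ "{v, x}"]) auto
    qed
    show "low S \<subseteq> S - {}" by (auto simp: low_def)
  qed (use fin clique_cover_ecover in \<open>auto simp: clique_def\<close>)
  then show ?thesis by simp
qed

text \<open>
  The set of \<open>u\<close> is assembled from the labels of those edges at \<open>v\<close> that
  lead to neighbours of \<open>u\<close>. It lies in the set of \<open>v\<close>, and it meets the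
  set of a third vertex only if that is a neighbour of \<open>u\<close>. The mark, shared by
  \<open>u\<close> and \<open>v\<close>, keeps the set of \<open>u\<close> from lying in that of
  its only neighbour if \<open>u\<close> has degree one.
\<close>

lemma representable_nested:
  assumes fin: "finite S" and u: "u \<in> S" and v: "v \<in> S" "u \<noteq> v" "\<not> adj u v"
    and dom: "nbrs S u \<subseteq> nbrs S v"
  shows "representable S (card (edges (S - {u})) + card (low (S - {u})) + 1)"
proof (rule representableI)
  define H where "H = S - {u}"
  define f where "f w = (if w = u then insert (Mark {}) {Clique {v, x} |x. x \<in> nbrs S u}
      else {Clique e |e. e \<in> edges H \<and> w \<in> e} \<union> (if w \<in> low H then {Own w} else {})
           \<union> (if w = v then {Mark {}} else {}))" for w
  define U where "U = Clique ` edges H \<union> Own ` low H \<union> {Mark {}}"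
  have finH: "finite H" and finL: "finite (low H)"
    using fin by (auto simp: H_def low_def)
  have vH: "v \<in> H" using v by (simp add: H_def)
  have vx: "{v, x} \<in> edges H \<and> x \<in> H \<and> x \<noteq> v" if "x \<in> nbrs S u" for x
    using that dom vH adj_irrefl unfolding nbrs_def H_def
    by (auto simp: doubleton_in_edges)
  show "finite U" using finH finL by (simp add: U_def)
  have "card U \<le> card (Clique ` edges H \<union> Own ` low H) + card {Mark {} :: 'a label}"
    unfolding U_def by (rule card_Un_le)
  also have "\<dots> \<le> card (Clique ` edges H) + card (Own ` low H) + 1"
    using card_Un_le by simp
  also have "\<dots> \<le> card (edges H) + card (low H) + 1"
    using card_image_le[OF finite_edges[OF finH]] card_image_le[OF finL] by (intro add_mono order_refl)
  finally show "card U \<le> card (edges (S - {u})) + card (low (S - {u})) + 1"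
    by (simp add: H_def)
  show "f w \<subseteq> U" if "w \<in> S" for w
    using vx by (auto simp: f_def U_def)
  have other_edge: "\<exists>e \<in> edges H. w \<in> e \<and> x \<notin> e"
    if w: "w \<in> H" "w \<notin> low H" "w \<noteq> x" for w x
  proof -
    obtain y where "y \<in> H" "adj w y" "y \<noteq> x"
      using not_low_obtains[OF finH w(1,2), of x] by blast
    then show ?thesis using w by (intro bexI[of _ "{w, y}"]) (auto simp: doubleton_in_edges)
  qed
  have HH: "adj w z \<longleftrightarrow> overlap (f w) (f z)" if wz: "w \<in> H" "z \<in> H" "w \<noteq> z" for w z
  proof
    assume a: "adj w z"
    have not_sub: "\<not> f w \<subseteq> f z" if wz: "w \<in> H" "z \<in> H" "w \<noteq> z" for w z
    proof (cases "w \<in> low H")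
      case True
      then have "Own w \<in> f w - f z" using that by (auto simp: f_def H_def)
      then show ?thesis by blast
    next
      case False
      then obtain e where "e \<in> edges H" "w \<in> e" "z \<notin> e" using other_edge wz by blast
      then have "Clique e \<in> f w - f z" using that by (auto simp: f_def H_def)
      then show ?thesis by blast
    qed
    have "Clique {w, z} \<in> f w \<inter> f z"
      using wz a by (auto simp: f_def H_def doubleton_in_edges)
    then show "overlap (f w) (f z)" unfolding overlap_def using not_sub[of w z] not_sub[of z w] wz by auto
  next
    assume "overlap (f w) (f z)"
    then obtain l where "l \<in> f w" "l \<in> f z" unfolding overlap_def by blast
    then obtain e where "e \<in> edges H" "w \<in> e" "z \<in> e"
      using wz by (auto simp: f_def H_def split: if_splits)
    then show "adj w z" using wz adj_commute unfolding edges_def by auto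
  qed
  have uH: "adj u w \<longleftrightarrow> overlap (f u) (f w)" if w: "w \<in> H" for w
  proof
    assume a: "adj u w"
    then have wn: "w \<in> nbrs S u" and "w \<noteq> v" "w \<noteq> u"
      using w v adj_irrefl by (auto simp: nbrs_def H_def)
    have "Clique {v, w} \<in> f u \<inter> f w"
      using vx[OF wn] wn \<open>w \<noteq> u\<close> by (auto simp: f_def)
    moreover have "Mark {} \<in> f u - f w"
      using \<open>w \<noteq> v\<close> \<open>w \<noteq> u\<close> by (auto simp: f_def)
    moreover have "\<not> f w \<subseteq> f u"
    proof (cases "w \<in> low H")
      case True
      then have "Own w \<in> f w - f u" using \<open>w \<noteq> u\<close> by (auto simp: f_def)
      then show ?thesis by blast
    next
      case False
      then obtain e where "e \<in> edges H" "w \<in> e" "v \<notin> e" using other_edge w \<open>w \<noteq> v\<close> by blast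
      then have "Clique e \<in> f w - f u" using \<open>w \<noteq> u\<close> by (auto simp: f_def)
      then show ?thesis by blast
    qed
    ultimately show "overlap (f u) (f w)" unfolding overlap_def by blast
  next
    assume o: "overlap (f u) (f w)"
    show "adj u w"
    proof (rule ccontr)
      assume na: "\<not> adj u w"
      have "w \<noteq> u" using w by (simp add: H_def)
      show False
      proof (cases "w = v")
        case True
        then have "f u \<subseteq> f w" using vx \<open>w \<noteq> u\<close> by (auto simp: f_def)
        then show False using o by (simp add: overlap_def)
      next
        case False
        then have "f u \<inter> f w = {}" using na \<open>w \<noteq> u\<close> by (auto simp: f_def nbrs_def)
        then show False using o by (simp add: overlap_def)
      qed
    qed
  qed
  show "adj w z \<longleftrightarrow> overlap (f w) (f z)" if "w \<in> S" "z \<in> S" "w \<noteq> z" for w z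
    using that HH uH[of z] uH[of w] adj_commute overlap_sym unfolding H_def
    by (cases "w = u"; cases "z = u") blast+
qed

section \<open>Counting edges in triangle-free graphs\<close>

lemma sum_deg: "finite S \<Longrightarrow> (\<Sum>v \<in> S. deg S v) = 2 * card (edges S)"
proof -
  assume fin: "finite S"
  have deg: "deg S v = card {e \<in> edges S. v \<in> e}" if "v \<in> S" for v
  proof -
    have "{e \<in> edges S. v \<in> e} = (\<lambda>w. {v, w}) ` nbrs S v"
      using that adj_sym by (auto simp: edges_def nbrs_def)
    moreover have "inj_on (\<lambda>w. {v, w}) (nbrs S v)"
      by (auto simp: inj_on_def doubleton_eq_iff)
    ultimately show ?thesis by (simp add: deg_def card_image)
  qed
  have two: "card {v \<in> S. v \<in> e} = 2" if e: "e \<in> edges S" for e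
  proof -
    obtain u v where uv: "e = {u, v}" "u \<in> S" "v \<in> S" "adj u v"
      using e by (auto simp: edges_def)
    then have "{x \<in> S. x \<in> e} = {u, v}" by auto
    then show ?thesis using adj_neq[OF uv(4)] by simp
  qed
  have "(\<Sum>v \<in> S. deg S v) = (\<Sum>v \<in> S. card {e \<in> edges S. v \<in> e})"
    using deg by simp
  also have "\<dots> = (\<Sum>v \<in> S. \<Sum>e \<in> edges S. if v \<in> e then 1 else 0)"
    using fin by (intro sum.cong) (auto simp: sum.If_cases Int_def)
  also have "\<dots> = (\<Sum>e \<in> edges S. \<Sum>v \<in> S. if v \<in> e then 1 else 0)"
    by (rule sum.swap)
  also have "\<dots> = (\<Sum>e \<in> edges S. card {v \<in> S. v \<in> e})"
    using fin by (intro sum.cong) (auto simp: sum.If_cases Int_def)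
  also have "\<dots> = 2 * card (edges S)"
    using two by simp
  finally show ?thesis .
qed

text \<open>
  Write $d$ for the degree function. Summing \<open>d u + d v\<close> over the ordered adjacent
  pairs gives $2\sum d^2 \le s\sum d$, and $\sum(2d-s)^2 \ge 0$ turns this into $2\sum d \le
  s\,n$, which is the claim by the handshake lemma. With \<open>s = n\<close> this is Mantel's
  theorem; the sharper values of \<open>s\<close> are used below.
\<close>

lemma edges_le_of_degree_sum:
  assumes fin: "finite S"
    and bound: "\<And>u v. u \<in> S \<Longrightarrow> v \<in> S \<Longrightarrow> adj u v \<Longrightarrow> deg S u + deg S v \<le> s"
  shows "4 * card (edges S) \<le> s * card S"
proof (cases "edges S = {}")
  case True
  then show ?thesis by simp
next
  case False
  then obtain u v where "u \<in> S" "v \<in> S" "adj u v" by (auto simp: edges_def)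
  moreover have "v \<in> nbrs S u" using calculation by (simp add: nbrs_def)
  then have "deg S u > 0" using fin by (auto simp: deg_def card_gt_0_iff)
  ultimately have s: "s > 0" using bound[of u v] by simp
  define d where "d v = int (deg S v)" for v
  define A where "A = (\<Sum>v \<in> S. d v)"
  have "(\<Sum>v \<in> S. \<Sum>u \<in> nbrs S v. d u) = (\<Sum>v \<in> S. \<Sum>u \<in> S. if adj v u then d u else 0)"
    using fin by (simp add: nbrs_def sum.inter_filter)
  also have "\<dots> = (\<Sum>u \<in> S. \<Sum>v \<in> S. if adj v u then d u else 0)"
    by (rule sum.swap)
  also have "\<dots> = (\<Sum>u \<in> S. \<Sum>v \<in> nbrs S u. d u)"
    using fin by (simp add: nbrs_def sum.inter_filter adj_commute del: sum_constant)
  finally have swap: "(\<Sum>v \<in> S. \<Sum>u \<in> nbrs S v. d u) = (\<Sum>u \<in> S. \<Sum>v \<in> nbrs S u. d u)" .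
  have sq: "(\<Sum>v \<in> S. \<Sum>u \<in> nbrs S v. d v) = (\<Sum>v \<in> S. (d v)\<^sup>2)"
    by (simp add: d_def deg_def power2_eq_square)
  have "2 * (\<Sum>v \<in> S. (d v)\<^sup>2) = (\<Sum>v \<in> S. \<Sum>u \<in> nbrs S v. d v + d u)"
    using swap sq by (simp add: sum.distrib)
  also have "\<dots> \<le> (\<Sum>v \<in> S. \<Sum>u \<in> nbrs S v. int s)"
    using bound by (intro sum_mono) (force simp: d_def nbrs_def)
  also have "\<dots> = int s * A"
    by (simp add: A_def d_def deg_def sum_distrib_left mult.commute)
  finally have upper: "2 * (\<Sum>v \<in> S. (d v)\<^sup>2) \<le> int s * A" .
  have "0 \<le> (\<Sum>v \<in> S. (2 * d v - int s)\<^sup>2)" by (intro sum_nonneg) simp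
  also have "\<dots> = (\<Sum>v \<in> S. 4 * (d v)\<^sup>2 - 4 * int s * d v + (int s)\<^sup>2)"
    by (intro sum.cong) (auto simp: power2_eq_square algebra_simps)
  also have "\<dots> = 4 * (\<Sum>v \<in> S. (d v)\<^sup>2) - 4 * int s * A + int (card S) * (int s)\<^sup>2"
    by (simp add: sum.distrib sum_subtractf sum_distrib_left A_def)
  finally have "2 * int s * A \<le> int (card S) * (int s)\<^sup>2"
    using upper by linarith
  then have "int s * (2 * A) \<le> int s * (int s * int (card S))"
    by (simp add: power2_eq_square algebra_simps)
  then have "2 * A \<le> int s * int (card S)"
    using s by simp
  moreover have "A = int (2 * card (edges S))"
    using sum_deg[OF fin] by (simp add: A_def d_def flip: of_nat_sum)
  ultimately have "int (4 * card (edges S)) \<le> int (s * card S)"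
    by simp
  then show ?thesis by (simp only: of_nat_le_iff)
qed

lemma triangle_free_subset: "triangle_free S \<Longrightarrow> T \<subseteq> S \<Longrightarrow> triangle_free T"
  unfolding triangle_free_def by (meson subsetD)

lemma triangle_free_disjoint_nbrs:
  assumes "triangle_free S" "u \<in> S" "v \<in> S" "adj u v"
  shows "nbrs S u \<inter> nbrs S v = {}"
  using assms adj_sym unfolding triangle_free_def nbrs_def by blast

lemma triangle_free_degree_sum:
  assumes "finite S" "triangle_free S" "u \<in> S" "v \<in> S" "adj u v"
  shows "deg S u + deg S v = card (nbrs S u \<union> nbrs S v)"
  unfolding deg_def
  using card_Un_disjoint triangle_free_disjoint_nbrs[OF assms(2-5)] assms(1) by (metis finite_nbrs)

lemma mantel:
  assumes "finite S" "triangle_free S"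
  shows "4 * card (edges S) \<le> (card S)\<^sup>2"
proof -
  have "deg S u + deg S v \<le> card S" if "u \<in> S" "v \<in> S" "adj u v" for u v
    using triangle_free_degree_sum[OF assms that] assms(1)
    by (auto intro!: card_mono simp: nbrs_def)
  then show ?thesis
    using edges_le_of_degree_sum[OF assms(1), of "card S"] by (simp add: power2_eq_square)
qed

lemma bipartite_edges:
  assumes "finite X" "finite Y" "X \<inter> Y = {}"
    and X: "\<And>u v. u \<in> X \<Longrightarrow> v \<in> X \<Longrightarrow> \<not> adj u v"
    and Y: "\<And>u v. u \<in> Y \<Longrightarrow> v \<in> Y \<Longrightarrow> \<not> adj u v"
  shows "card (edges (X \<union> Y)) + card {p \<in> X \<times> Y. \<not> adj (fst p) (snd p)} = card X * card Y"
proof -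
  let ?E = "{p \<in> X \<times> Y. adj (fst p) (snd p)}"
  have "edges (X \<union> Y) = (\<lambda>p. {fst p, snd p}) ` ?E"
  proof (intro equalityI subsetI)
    fix e assume "e \<in> edges (X \<union> Y)"
    then obtain u v where uv: "e = {u, v}" "u \<in> X \<union> Y" "v \<in> X \<union> Y" "adj u v"
      by (auto simp: edges_def)
    then have "u \<in> X \<and> v \<in> Y \<or> v \<in> X \<and> u \<in> Y" using X Y by blast
    then show "e \<in> (\<lambda>p. {fst p, snd p}) ` ?E"
    proof
      assume "u \<in> X \<and> v \<in> Y"
      then show ?thesis using uv by (intro image_eqI[of _ _ "(u, v)"]) auto
    next
      assume "v \<in> X \<and> u \<in> Y"
      then show ?thesis using uv adj_sym by (intro image_eqI[of _ _ "(v, u)"]) auto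
    qed
  next
    fix e assume "e \<in> (\<lambda>p. {fst p, snd p}) ` ?E"
    then show "e \<in> edges (X \<union> Y)" by (auto simp: doubleton_in_edges)
  qed
  moreover have "inj_on (\<lambda>p. {fst p, snd p}) ?E"
    using assms(3) by (auto simp: inj_on_def doubleton_eq_iff)
  ultimately have "card (edges (X \<union> Y)) = card ?E" by (simp add: card_image)
  moreover have "card ?E + card {p \<in> X \<times> Y. \<not> adj (fst p) (snd p)} = card (X \<times> Y)"
  proof -
    have "X \<times> Y = ?E \<union> {p \<in> X \<times> Y. \<not> adj (fst p) (snd p)}" by auto
    moreover have "card \<dots> = card ?E + card {p \<in> X \<times> Y. \<not> adj (fst p) (snd p)}"
      using assms by (intro card_Un_disjoint) auto
    ultimately show ?thesis by simp
  qed
  ultimately show ?thesis by (simp add: card_cartesian_product)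
qed

text \<open>
  So many edges force an edge whose ends have degree sum at least \<open>card T\<close>. In a
  triangle-free graph the two neighbourhoods are disjoint and independent, hence they are a
  bipartition. Counting edges then gives $(|X|-|Y|)^2 + 4\mu \le 8$ for the number $\mu$ of
  missing pairs. The slack of 8 is what both applications leave.
\<close>

lemma almost_complete_bipartite:
  assumes fin: "finite T" and tf: "triangle_free T" and m: "card T \<ge> 9"
    and many: "(card T)\<^sup>2 \<le> 4 * card (edges T) + 8"
  obtains X Y where "T = X \<union> Y" "X \<inter> Y = {}"
    "\<And>u v. u \<in> X \<Longrightarrow> v \<in> X \<Longrightarrow> \<not> adj u v" "\<And>u v. u \<in> Y \<Longrightarrow> v \<in> Y \<Longrightarrow> \<not> adj u v"
    "card {p \<in> X \<times> Y. \<not> adj (fst p) (snd p)} \<le> 2"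
    "card T \<le> 2 * card X + 2" "card T \<le> 2 * card Y + 2"
proof -
  have "\<exists>u \<in> T. \<exists>v \<in> T. adj u v \<and> deg T u + deg T v \<ge> card T"
  proof (rule ccontr)
    assume "\<not> ?thesis"
    then have "4 * card (edges T) \<le> (card T - 1) * card T"
      by (intro edges_le_of_degree_sum[OF fin]) (fastforce simp: not_le)
    then show False using many m
      by (cases "card T") (auto simp: power2_eq_square)
  qed
  then obtain u v where uv: "u \<in> T" "v \<in> T" "adj u v" "deg T u + deg T v \<ge> card T" by blast
  define X Y where "X = nbrs T u" and "Y = nbrs T v"
  have "card (X \<union> Y) \<ge> card T"
    using uv triangle_free_degree_sum[OF fin tf] by (simp add: X_def Y_def)
  then have TXY: "T = X \<union> Y"
    using card_seteq[OF fin, of "X \<union> Y"] by (simp add: X_def Y_def nbrs_def subset_iff)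
  have disj: "X \<inter> Y = {}"
    unfolding X_def Y_def by (rule triangle_free_disjoint_nbrs[OF tf uv(1-3)])
  have X: "\<not> adj a b" if "a \<in> X" "b \<in> X" for a b
    using tf uv(1) that unfolding triangle_free_def X_def nbrs_def by blast
  have Y: "\<not> adj a b" if "a \<in> Y" "b \<in> Y" for a b
    using tf uv(2) that unfolding triangle_free_def Y_def nbrs_def by blast
  have finXY: "finite X" "finite Y" using fin by (auto simp: X_def Y_def)
  let ?M = "{p \<in> X \<times> Y. \<not> adj (fst p) (snd p)}"
  have count: "card (edges T) + card ?M = card X * card Y"
    unfolding TXY by (rule bipartite_edges[OF finXY disj X Y])
  have sum: "card T = card X + card Y"
    unfolding TXY using card_Un_disjoint[OF finXY disj] .
  define x y where "x = int (card X)" and "y = int (card Y)"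
  have "(x + y)\<^sup>2 \<le> 4 * (x * y - int (card ?M)) + 8"
  proof -
    have "int ((card T)\<^sup>2) \<le> int (4 * card (edges T) + 8)"
      using many by (simp only: of_nat_le_iff)
    moreover have "int (card (edges T)) = x * y - int (card ?M)"
      using count by (simp add: x_def y_def flip: of_nat_mult of_nat_add)
    ultimately show ?thesis using sum by (simp add: x_def y_def)
  qed
  then have diff: "(x - y)\<^sup>2 + 4 * int (card ?M) \<le> 8"
    by (simp add: power2_eq_square algebra_simps)
  then have "card ?M \<le> 2" using zero_le_power2[of "x - y"] by linarith
  moreover have "\<bar>x - y\<bar> < 3"
  proof -
    have "(x - y)\<^sup>2 < 3\<^sup>2" using diff by simp
    then show ?thesis using abs_le_square_iff[of 3 "x - y"] by simp
  qed
  then have "card T \<le> 2 * card X + 2" "card T \<le> 2 * card Y + 2"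
    using sum by (auto simp: x_def y_def)
  ultimately show thesis using that TXY disj X Y by blast
qed

lemma nonfull_le_missing:
  assumes "finite X" "finite Y"
  shows "card {a \<in> X. \<exists>b \<in> Y. \<not> adj a b} \<le> card {p \<in> X \<times> Y. \<not> adj (fst p) (snd p)}"
    and "card {b \<in> Y. \<exists>a \<in> X. \<not> adj b a} \<le> card {p \<in> X \<times> Y. \<not> adj (fst p) (snd p)}"
proof -
  let ?M = "{p \<in> X \<times> Y. \<not> adj (fst p) (snd p)}"
  have fin: "finite ?M" using assms by simp
  have "{a \<in> X. \<exists>b \<in> Y. \<not> adj a b} = fst ` ?M" by force
  then show "card {a \<in> X. \<exists>b \<in> Y. \<not> adj a b} \<le> card ?M"
    using card_image_le[OF fin] by simp
  have "{b \<in> Y. \<exists>a \<in> X. \<not> adj b a} = snd ` ?M" using adj_commute by force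
  then show "card {b \<in> Y. \<exists>a \<in> X. \<not> adj b a} \<le> card ?M"
    using card_image_le[OF fin] by simp
qed

text \<open>
  Each vertex of low degree accounts for at most one clique, its edge or its singleton. Together
  with Mantel's theorem for the others this shows that vertices of low degree make the graph
  sparse, which pays for their private labels.
\<close>

lemma card_ecover_le:
  assumes fin: "finite S"
  shows "card (ecover S) \<le> card (edges (S - low S)) + card (low S)"
proof -
  define g where "g v = insert v (nbrs S v)" for v
  have "e \<in> g ` low S" if e: "e \<in> ecover S" "e \<notin> edges (S - low S)" for e
  proof (cases "e \<in> edges S")
    case False
    then obtain v where "e = {v}" "v \<in> S" "nbrs S v = {}" using e by (auto simp: ecover_def)
    then show ?thesis by (intro image_eqI[of _ _ v]) (auto simp: g_def low_def deg_def)
  next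
    case True
    have *: "{u, v} \<in> g ` low S" if "u \<in> S" "v \<in> S" "adj u v" "u \<in> low S" for u v
    proof -
      have v: "v \<in> nbrs S u" using that by (simp add: nbrs_def)
      have "card (nbrs S u) \<le> 1" using that by (simp add: low_def deg_def)
      then have "nbrs S u = {v}" using v fin
        by (metis One_nat_def card_le_Suc0_iff_eq empty_iff finite_nbrs insertCI subsetI subset_singletonD)
      then show ?thesis using that by (intro image_eqI[of _ _ u]) (auto simp: g_def)
    qed
    obtain u v where uv: "e = {u, v}" "u \<in> S" "v \<in> S" "adj u v"
      using True by (auto simp: edges_def)
    then have "u \<in> low S \<or> v \<in> low S" using e(2) by (auto simp: doubleton_in_edges)
    then show ?thesis
    proof
      assume "u \<in> low S"
      then show ?thesis using *[of u v] uv by simp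
    next
      assume "v \<in> low S"
      then show ?thesis using *[of v u] uv adj_sym by (simp add: insert_commute)
    qed
  qed
  then have "ecover S \<subseteq> edges (S - low S) \<union> g ` low S" by blast
  then have "card (ecover S) \<le> card (edges (S - low S) \<union> g ` low S)"
    using fin by (intro card_mono) (auto simp: low_def)
  also have "\<dots> \<le> card (edges (S - low S)) + card (g ` low S)" by (rule card_Un_le)
  also have "\<dots> \<le> card (edges (S - low S)) + card (low S)"
    using fin by (intro add_left_mono card_image_le) (auto simp: low_def)
  finally show ?thesis .
qed

lemma triangle_free_ecover_le:
  assumes fin: "finite S" and tf: "triangle_free S"
  shows "4 * card (ecover S) \<le> (card S - card (low S))\<^sup>2 + 4 * card (low S)"
proof -
  have "low S \<subseteq> S" by (auto simp: low_def)
  then have "card (S - low S) = card S - card (low S)"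
    using fin by (intro card_Diff_subset) (auto intro: finite_subset)
  moreover have "4 * card (edges (S - low S)) \<le> (card (S - low S))\<^sup>2"
    using fin by (intro mantel triangle_free_subset[OF tf]) auto
  ultimately show ?thesis using card_ecover_le[OF fin] by simp
qed

lemma ecover_eq_edges:
  assumes "finite S" "low S = {}"
  shows "ecover S = edges S"
  using assms unfolding ecover_def low_def deg_def by auto

lemma card_low_le: "finite S \<Longrightarrow> card (low S) \<le> card S"
  by (intro card_mono) (auto simp: low_def)

section \<open>Covering edges by cliques\<close>

text \<open>
  One new clique for each outside vertex, joining it to its neighbours in \<open>Q\<close>, and
  one for \<open>Q\<close>.
\<close>

lemma clique_cover_extend:
  assumes fin: "finite S" and Q: "Q \<subseteq> S" "clique Q" and C: "clique_cover (S - Q) C"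
  obtains C' where "clique_cover S C'" "card C' \<le> card C + card (S - Q) + 1" "\<Union>C \<union> Q \<subseteq> \<Union>C'"
proof
  define g where "g v = insert v (nbrs Q v)" for v
  let ?C = "insert Q (C \<union> g ` (S - Q))"
  have finC: "finite C" using C by (simp add: clique_cover_def)
  have g: "g v \<subseteq> S \<and> clique (g v)" if "v \<in> S - Q" for v
    using that Q adj_sym unfolding clique_def g_def nbrs_def by auto
  have "\<exists>c \<in> ?C. u \<in> c \<and> v \<in> c" if uv: "u \<in> S" "v \<in> S" "adj u v" for u v
  proof (cases "u \<in> Q")
    case True
    show ?thesis
    proof (cases "v \<in> Q")
      case True
      then show ?thesis using \<open>u \<in> Q\<close> by blast
    next
      case False
      then have "g v \<in> ?C" "u \<in> g v" "v \<in> g v"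
        using \<open>u \<in> Q\<close> uv adj_sym by (auto simp: g_def nbrs_def)
      then show ?thesis by blast
    qed
  next
    case False
    show ?thesis
    proof (cases "v \<in> Q")
      case True
      then have "g u \<in> ?C" "u \<in> g u" "v \<in> g u"
        using uv False by (auto simp: g_def nbrs_def)
      then show ?thesis by blast
    next
      case F: False
      then obtain c where "c \<in> C" "u \<in> c" "v \<in> c"
        using C uv False unfolding clique_cover_def by blast
      then show ?thesis by blast
    qed
  qed
  moreover have "c \<subseteq> S \<and> clique c" if "c \<in> ?C" for c
    using that Q g C unfolding clique_cover_def by auto
  ultimately show "clique_cover S ?C"
    using finC fin unfolding clique_cover_def by auto
  have "card ?C \<le> card (C \<union> g ` (S - Q)) + 1"
    using finC fin by (simp add: card_insert_if)
  also have "\<dots> \<le> card C + card (g ` (S - Q)) + 1"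
    using card_Un_le by simp
  also have "\<dots> \<le> card C + card (S - Q) + 1"
    using card_image_le[of "S - Q" g] fin by simp
  finally show "card ?C \<le> card C + card (S - Q) + 1" .
  show "\<Union>C \<union> Q \<subseteq> \<Union>?C" by auto
qed

text \<open>
  Removing the two ends of an edge costs $n-1$ cliques, which is the difference between $n^2/4$
  and $(n-2)^2/4$.
\<close>

lemma erdos_goodman_posa:
  assumes "finite S"
  shows "\<exists>C. clique_cover S C \<and> 4 * card C \<le> (card S)\<^sup>2"
  using assms
proof (induction S rule: finite_psubset_induct)
  case (psubset S)
  show ?case
  proof (cases "edges S = {}")
    case True
    then have "clique_cover S {}"
      unfolding clique_cover_def using doubleton_in_edges by auto
    then show ?thesis by (intro exI[of _ "{}"]) simp
  next
    case False
    then obtain u v where uv: "u \<in> S" "v \<in> S" "adj u v" by (auto simp: edges_def)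
    have "u \<noteq> v" using uv adj_neq by simp
    have "S - {u, v} \<subset> S" using uv by auto
    from psubset.IH[OF this] obtain C
      where C: "clique_cover (S - {u, v}) C" "4 * card C \<le> (card (S - {u, v}))\<^sup>2" by blast
    have "clique {u, v}" using uv adj_sym by (auto simp: clique_def)
    obtain C' where C': "clique_cover S C'" "card C' \<le> card C + card (S - {u, v}) + 1"
      by (rule clique_cover_extend[OF psubset.hyps(1) _ \<open>clique {u, v}\<close> C(1)]) (use uv in auto)
    have card: "card S = card (S - {u, v}) + 2"
      using uv \<open>u \<noteq> v\<close> psubset.hyps(1) card_Diff_subset[of "{u, v}" S] card_mono[of S "{u, v}"]
      by auto
    have "4 * card C' \<le> (card S)\<^sup>2"
      using C'(2) C(2) unfolding card by (simp add: power2_eq_square)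
    then show ?thesis using C'(1) by blast
  qed
qed

text \<open>
  If isolated vertices are to be covered as well, each of them costs a singleton. From four
  vertices on this is no more than what their absence from the edges saves.
\<close>

lemma erdos_goodman_posa_vertices:
  assumes fin: "finite S" and large: "card S \<ge> 4"
  shows "\<exists>C. clique_cover S C \<and> \<Union>C = S \<and> 4 * card C \<le> (card S)\<^sup>2"
proof -
  define I where "I = {v \<in> S. nbrs S v = {}}"
  obtain C where C: "clique_cover (S - I) C" "4 * card C \<le> (card (S - I))\<^sup>2"
    using erdos_goodman_posa[of "S - I"] fin by auto
  let ?C = "C \<union> (\<lambda>v. {v}) ` I"
  have finI: "finite I" and IS: "I \<subseteq> S" using fin by (auto simp: I_def)
  have finC: "finite C" using C(1) by (simp add: clique_cover_def)
  have nonI: "u \<in> S - I" if "u \<in> S" "v \<in> S" "adj u v" for u v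
    using that by (auto simp: I_def nbrs_def)
  have edge: "\<exists>c \<in> C. u \<in> c \<and> v \<in> c" if "u \<in> S" "v \<in> S" "adj u v" for u v
    using C(1) nonI[OF that] nonI[of v u] that adj_sym unfolding clique_cover_def by blast
  have "c \<subseteq> S \<and> clique c" if "c \<in> ?C" for c
    using that C(1) IS unfolding clique_cover_def by (auto simp: clique_def)
  then have "clique_cover S ?C"
    unfolding clique_cover_def using finC finI edge
    by (intro conjI ballI impI) (simp, blast, blast, meson UnI1)
  moreover have "\<Union>?C = S"
  proof (intro equalityI subsetI)
    fix v assume v: "v \<in> S"
    show "v \<in> \<Union>?C"
    proof (cases "v \<in> I")
      case False
      then obtain w where "w \<in> S" "adj v w" using v by (auto simp: I_def nbrs_def)
      then show ?thesis using edge[of v w] v by blast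
    qed auto
  qed (use C(1) IS in \<open>auto simp: clique_cover_def\<close>)
  moreover have "4 * card ?C \<le> (card S)\<^sup>2"
  proof -
    have "card ?C \<le> card C + card I"
      using card_Un_le[of C "(\<lambda>v. {v}) ` I"] card_image_le[OF finI, of "\<lambda>v. {v}"] by linarith
    moreover define p i where "p = card (S - I)" and "i = card I"
    moreover have S: "card S = p + i"
      using fin IS card_Diff_subset[OF finI IS] card_mono[OF fin IS] by (simp add: p_def i_def)
    moreover have "4 * i \<le> i * (2 * p + i)"
    proof (cases "i = 0")
      case False
      then have "4 \<le> 2 * p + i \<or> (i = 0)"
        using S large by simp
      then show ?thesis by auto
    qed simp
    ultimately show ?thesis
      using C(2) by (simp add: power2_eq_square algebra_simps)
  qed
  ultimately show ?thesis by (intro exI[of _ ?C] conjI)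
qed

text \<open>
  The generous form of the big-clique construction: every vertex outside \<open>Q\<close> gets a
  private label and every vertex of \<open>Q\<close> a mark. Two singletons are added to the cover
  so that no vertex lies in all of its members, which might make the set of that vertex contain a
  big one.
\<close>

lemma representable_clique_cover:
  assumes fin: "finite S" and Q: "Q \<subseteq> S" "clique Q"
    and C: "clique_cover (S - Q) C" "\<Union>C = S - Q" and two: "card (S - Q) \<ge> 2"
  shows "representable S (card C + 2 + card S)"
proof -
  obtain w w' where w: "w \<in> S - Q" "w' \<in> S - Q" "w \<noteq> w'"
    using two fin by (metis One_nat_def Suc_1 card_le_Suc0_iff_eq finite_Diff not_less_eq_eq)
  let ?C = "insert {w} (insert {w'} C)"
  let ?R = "(\<lambda>q. {q}) ` Q"
  have finQ: "finite Q" using Q(1) fin finite_subset by blast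
  have "representable S (card ?C + card (S - Q) + card ?R)"
  proof (rule representable_big_clique[OF fin Q])
    show "clique_cover (S - Q) ?C"
      using C(1) w unfolding clique_cover_def by (auto simp: clique_def)
    show "\<Union>?C = S - Q" using C(2) w by auto
    show "(\<exists>c \<in> ?C. v \<notin> c) \<or> (\<exists>x \<in> S - Q. x \<noteq> v \<and> \<not> adj q x)" for v q
      using w(3) by auto
  qed (use finQ in auto)
  moreover have "card ?C \<le> card C + 2"
    using C(1) by (auto simp: clique_cover_def card_insert_if)
  moreover have "card ?R \<le> card Q" by (rule card_image_le[OF finQ])
  moreover have "card (S - Q) + card Q = card S"
    using card_Diff_subset[OF finQ Q(1)] card_mono[OF fin Q(1)] by simp
  ultimately show ?thesis by (elim representable_mono) linarith
qed

text \<open>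
  The target bound on the size, cleared of fractions.
\<close>

definition small :: "'a set \<Rightarrow> bool" where
  "small S \<longleftrightarrow> (\<exists>k. representable S k \<and> 4 * k + 2 * card S + 4 \<le> (card S)\<^sup>2)"

lemma card_Diff_sub: "finite S \<Longrightarrow> Q \<subseteq> S \<Longrightarrow> card (S - Q) + card Q = card S"
  by (metis card_Diff_subset card_mono finite_subset le_add_diff_inverse2)

text \<open>
  The resulting size is at most $n^2/4-n+6$, which meets the bound from \<open>n = 14\<close> on.
\<close>

lemma small_if_K4:
  assumes fin: "finite S" and n: "card S \<ge> 14" and Q: "Q \<subseteq> S" "clique Q" "card Q = 4"
  shows "small S"
proof -
  have H: "card (S - Q) + 4 = card S" using card_Diff_sub[OF fin Q(1)] Q(3) by simp
  then have "4 \<le> card (S - Q)" using n by simp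
  from erdos_goodman_posa_vertices[OF finite_Diff[OF fin] this]
  obtain C where C: "clique_cover (S - Q) C" "\<Union>C = S - Q" "4 * card C \<le> (card (S - Q))\<^sup>2"
    by blast
  have "representable S (card C + 2 + card S)"
    using representable_clique_cover[OF fin Q(1,2) C(1,2)] H n by simp
  moreover have "4 * (card C + 2 + card S) + 2 * card S + 4 \<le> (card S)\<^sup>2"
    using C(3) n unfolding H[symmetric] by (simp add: power2_eq_square algebra_simps)
  ultimately show ?thesis unfolding small_def by blast
qed

text \<open>
  One triangle is the big clique, and the other one is split off the clique cover of the rest at
  the price of one clique for each remaining vertex. Again the size is at most $n^2/4-n+6$.
\<close>

lemma small_if_disjoint_triangles:
  assumes fin: "finite S" and n: "card S \<ge> 14"
    and Q: "Q \<subseteq> S" "clique Q" "card Q = 3" and P: "P \<subseteq> S - Q" "clique P" "card P = 3"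
  shows "small S"
proof -
  have H: "card (S - Q) + 3 = card S" using card_Diff_sub[OF fin Q(1)] Q(3) by simp
  have H': "card (S - Q - P) + 3 = card (S - Q)" using card_Diff_sub[OF _ P(1)] fin P(3) by simp
  have "4 \<le> card (S - Q - P)" using n H H' by simp
  from erdos_goodman_posa_vertices[OF finite_Diff[OF finite_Diff[OF fin]] this]
  obtain C where C: "clique_cover (S - Q - P) C" "\<Union>C = S - Q - P"
      "4 * card C \<le> (card (S - Q - P))\<^sup>2"
    by blast
  obtain C' where C': "clique_cover (S - Q) C'" "card C' \<le> card C + card (S - Q - P) + 1"
      "\<Union>C \<union> P \<subseteq> \<Union>C'"
    by (rule clique_cover_extend[OF finite_Diff[OF fin] P(1,2) C(1)])
  have "\<Union>C' = S - Q"
  proof (rule equalityI)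
    show "\<Union>C' \<subseteq> S - Q" using C'(1) unfolding clique_cover_def by (simp add: Sup_le_iff)
    show "S - Q \<subseteq> \<Union>C'" using C'(3) C(2) by auto
  qed
  then have "representable S (card C' + 2 + card S)"
    using representable_clique_cover[OF fin Q(1,2) C'(1)] H n by simp
  moreover have "4 * (card C' + 2 + card S) + 2 * card S + 4 \<le> (card S)\<^sup>2"
  proof -
    define p where "p = card (S - Q - P)"
    have "card S = p + 6" using H H' by (simp add: p_def)
    then show ?thesis using C(3) C'(2) n
      by (simp add: power2_eq_square algebra_simps flip: p_def)
  qed
  ultimately show ?thesis unfolding small_def by blast
qed

lemma small_if_twins_and_triangle:
  assumes fin: "finite S" and n: "card S \<ge> 14"
    and twins: "u \<in> S" "v \<in> S" "u \<noteq> v" "nbrs S u = nbrs S v"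
    and Q: "Q \<subseteq> S - {u}" "clique Q" "card Q = 3"
  shows "small S"
proof -
  let ?T = "S - {u}"
  have T: "card ?T + 1 = card S" using card_Diff_sub[OF fin, of "{u}"] twins by simp
  have H: "card (?T - Q) + 3 = card ?T" using card_Diff_sub[OF _ Q(1)] fin Q(3) by simp
  have "4 \<le> card (?T - Q)" using n H T by simp
  from erdos_goodman_posa_vertices[OF finite_Diff[OF finite_Diff[OF fin]] this]
  obtain C where C: "clique_cover (?T - Q) C" "\<Union>C = ?T - Q" "4 * card C \<le> (card (?T - Q))\<^sup>2"
    by blast
  have "representable ?T (card C + 2 + card ?T)"
    using representable_clique_cover[OF _ Q(1,2) C(1,2)] fin H T n by simp
  then have "representable S (card C + 2 + card ?T)"
    by (rule representable_of_twins[rotated 3]) (use fin twins in auto)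
  moreover have "4 * (card C + 2 + card ?T) + 2 * card S + 4 \<le> (card S)\<^sup>2"
  proof -
    define p where "p = card (?T - Q)"
    have "card S = p + 4" "card ?T = p + 3" using H T by (simp_all add: p_def)
    then show ?thesis using C(3) n
      by (simp add: power2_eq_square algebra_simps flip: p_def)
  qed
  ultimately show ?thesis unfolding small_def by blast
qed

section \<open>Triangle-free graphs\<close>

text \<open>
  Few distinct neighbourhoods mean few classes of twins, and one vertex from each class can be
  represented by edges and private labels: with at most nine vertices this takes fewer than the 41
  labels that the bound allows for 14 vertices.
\<close>

lemma small_if_few_neighbourhoods:
  assumes fin: "finite S" and n: "card S \<ge> 14" and tf: "triangle_free S"
    and few: "card (nbrs S ` S) \<le> 9"
  shows "small S"
proof -
  define T where "T = inv_into S (nbrs S) ` (nbrs S ` S)"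
  have TS: "T \<subseteq> S" by (auto simp: T_def inv_into_into)
  then have finT: "finite T" using fin finite_subset by blast
  have T: "card T \<le> 9"
    using few card_image_le[of "nbrs S ` S" "inv_into S (nbrs S)"] fin by (simp add: T_def)
  have "representable T (card (ecover T) + card (low T))"
    by (rule representable_ecover[OF finT])
  then have rep: "representable S (card (ecover T) + card (low T))"
  proof (rule representable_of_twins[OF finT TS, rotated])
    fix v assume "v \<in> S"
    then show "\<exists>w \<in> T. nbrs S w = nbrs S v"
      unfolding T_def by (meson f_inv_into_f image_eqI imageI)
  qed
  define t l where "t = card T" and "l = card (low T)"
  have "(t - l)\<^sup>2 \<le> 9\<^sup>2" using T by (intro power_mono) (auto simp: t_def)
  moreover have "l \<le> 9" using T card_low_le[OF finT] by (simp add: l_def)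
  moreover have "4 * card (ecover T) \<le> (t - l)\<^sup>2 + 4 * l"
    unfolding t_def l_def by (rule triangle_free_ecover_le[OF finT triangle_free_subset[OF tf TS]])
  ultimately have "4 * (card (ecover T) + l) \<le> 153" by simp
  moreover have "157 + 2 * card S \<le> (card S)\<^sup>2"
  proof -
    have "14 * card S \<le> card S * card S" using n by simp
    then show ?thesis using n unfolding power2_eq_square by linarith
  qed
  ultimately show ?thesis
    using rep unfolding small_def l_def by (intro exI conjI) (assumption, linarith)
qed

text \<open>
  Nesting \<open>u\<close> in \<open>v\<close> leaves the edges of \<open>H = S - {u}\<close> and
  one more label; vertices of low degree make \<open>H\<close> sparse enough to pay for theirs. If
  that is too many, then \<open>H\<close> is almost complete bipartite. Apart from
  \<open>u\<close> and the at most four ends of missing edges, the neighbourhood of a vertex is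
  then one whole side, with or without \<open>u\<close>.
\<close>

lemma small_if_dominated:
  assumes fin: "finite S" and n: "card S \<ge> 14" and tf: "triangle_free S"
    and u: "u \<in> S" and v: "v \<in> S" "u \<noteq> v" "\<not> adj u v" and dom: "nbrs S u \<subseteq> nbrs S v"
  shows "small S"
proof -
  define H where "H = S - {u}"
  define m where "m = card H"
  have finH: "finite H" using fin by (simp add: H_def)
  have tfH: "triangle_free H" using triangle_free_subset[OF tf] by (simp add: H_def)
  have m: "card S = m + 1" "m \<ge> 13"
    using card_Diff_sub[OF fin, of "{u}"] u n by (simp_all add: H_def m_def)
  have small: "small S" if "4 * (card (edges H) + card (low H)) + 9 \<le> m\<^sup>2"
  proof -
    have "representable S (card (edges H) + card (low H) + 1)"
      using representable_nested[OF fin u v dom] by (simp add: H_def)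
    moreover have "4 * (card (edges H) + card (low H) + 1) + 2 * card S + 4 \<le> (card S)\<^sup>2"
      using that m by (simp add: power2_eq_square)
    ultimately show ?thesis unfolding small_def by blast
  qed
  show ?thesis
  proof (cases "4 * (card (edges H) + card (low H)) + 9 \<le> m\<^sup>2")
    case True
    then show ?thesis by (rule small)
  next
    case False
    have "low H = {}"
    proof (rule ccontr)
      assume ne: "low H \<noteq> {}"
      define l p where "l = card (low H)" and "p = m - l"
      have "finite (low H)" using finH by (simp add: low_def)
      then have l: "l \<ge> 1" using ne by (simp add: l_def Suc_le_eq card_gt_0_iff)
      have mp: "m = p + l" using card_low_le[OF finH] by (simp add: p_def l_def m_def)
      have "card (edges H) \<le> card (ecover H)"
        using clique_cover_ecover(1)[OF finH]
        by (intro card_mono) (auto simp: clique_cover_def ecover_def)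
      then have "4 * card (edges H) \<le> p\<^sup>2 + 4 * l"
        using triangle_free_ecover_le[OF finH tfH] by (simp add: p_def l_def m_def)
      moreover have "8 * l + 9 \<le> 2 * (p * l) + l * l"
      proof (cases "l = 1")
        case True
        then show ?thesis using mp m(2) by simp
      next
        case False
        have "13 * l \<le> (p + l) * l" using m(2) mp by (intro mult_right_mono) auto
        then show ?thesis using False l by (simp add: algebra_simps)
      qed
      ultimately show False
        using False unfolding l_def[symmetric] mp by (simp add: power2_eq_square algebra_simps)
    qed
    then have many: "(card H)\<^sup>2 \<le> 4 * card (edges H) + 8"
      using False by (simp add: m_def)
    have nine: "9 \<le> card H" using m(2) by (simp add: m_def)
    obtain X Y where XY: "H = X \<union> Y" "X \<inter> Y = {}"
      and X: "\<And>u v. u \<in> X \<Longrightarrow> v \<in> X \<Longrightarrow> \<not> adj u v"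
      and Y: "\<And>u v. u \<in> Y \<Longrightarrow> v \<in> Y \<Longrightarrow> \<not> adj u v"
      and missing: "card {p \<in> X \<times> Y. \<not> adj (fst p) (snd p)} \<le> 2"
      by (rule almost_complete_bipartite[OF finH tfH nine many]) (rule that; assumption)
    define X0 Y0 where "X0 = {a \<in> X. \<exists>b \<in> Y. \<not> adj a b}" and "Y0 = {b \<in> Y. \<exists>a \<in> X. \<not> adj b a}"
    have finXY: "finite X" "finite Y" using finH by (simp_all add: XY(1))
    have "card X0 \<le> 2" "card Y0 \<le> 2"
      using nonfull_le_missing[OF finXY] missing by (simp_all add: X0_def Y0_def)
    have uH: "u \<notin> X" "u \<notin> Y" "S = insert u (X \<union> Y)"
      using XY(1) u by (auto simp: H_def)
    have fullX: "nbrs S a \<in> {Y, insert u Y}" if "a \<in> X" "a \<notin> X0" for a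
    proof -
      have "nbrs S a = (if adj a u then insert u Y else Y)"
        using that X uH(3) by (auto simp: nbrs_def X0_def)
      then show ?thesis by simp
    qed
    have fullY: "nbrs S b \<in> {X, insert u X}" if "b \<in> Y" "b \<notin> Y0" for b
    proof -
      have "nbrs S b = (if adj b u then insert u X else X)"
        using that Y uH(3) by (auto simp: nbrs_def Y0_def)
      then show ?thesis by simp
    qed
    define R where "R = insert u (X0 \<union> Y0)"
    have "nbrs S ` S \<subseteq> nbrs S ` R \<union> {Y, insert u Y, X, insert u X}"
      using fullX fullY unfolding uH(3) R_def by blast
    moreover have "finite R" using finXY by (simp add: R_def X0_def Y0_def)
    ultimately have "card (nbrs S ` S) \<le> card (nbrs S ` R \<union> {Y, insert u Y, X, insert u X})"
      by (intro card_mono) auto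
    also have "\<dots> \<le> card (nbrs S ` R) + card {Y, insert u Y, X, insert u X}"
      by (rule card_Un_le)
    also have "\<dots> \<le> card R + 4"
      using card_image_le[OF \<open>finite R\<close>, of "nbrs S"]
        card_length[of "[Y, insert u Y, X, insert u X]"] by simp
    also have "card R \<le> card (X0 \<union> Y0) + 1"
      using finXY by (simp add: R_def card_insert_if X0_def Y0_def)
    also have "card (X0 \<union> Y0) \<le> 4"
      using card_Un_le[of X0 Y0] \<open>card X0 \<le> 2\<close> \<open>card Y0 \<le> 2\<close> by linarith
    finally show ?thesis
      by (intro small_if_few_neighbourhoods[OF fin n tf]) simp
  qed
qed

text \<open>
  Suppose that at most one vertex \<open>z\<close> lies outside both neighbourhoods. A neighbour
  \<open>v \<noteq> x\<close> of \<open>y\<close> is not dominated by \<open>x\<close>, and the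
  neighbour of \<open>v\<close> that witnesses this can only be \<open>z\<close>. The same holds
  for the neighbours of \<open>x\<close>. So a neighbour of \<open>x\<close> other than
  \<open>y\<close> is not adjacent to \<open>v\<close>, as the two would form a triangle with
  \<open>z\<close>, and \<open>v\<close> has only the neighbours \<open>y\<close> and
  \<open>z\<close>. Two such vertices would be twins. Hence \<open>x\<close> and \<open>y\<close>
  have degree at most two, as in the 5-cycle.
\<close>

lemma undominated_degree_sum:
  assumes fin: "finite S" and n: "card S \<ge> 6" and tf: "triangle_free S" and low: "low S = {}"
    and undom: "\<And>u v. u \<in> S \<Longrightarrow> v \<in> S \<Longrightarrow> u \<noteq> v \<Longrightarrow> \<not> adj u v \<Longrightarrow> \<not> nbrs S u \<subseteq> nbrs S v"
    and xy: "x \<in> S" "y \<in> S" "adj x y"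
  shows "deg S x + deg S y + 2 \<le> card S"
proof (rule ccontr)
  assume neg: "\<not> ?thesis"
  have no_tri: False if "a \<in> S" "b \<in> S" "c \<in> S" "adj a b" "adj b c" "adj a c" for a b c
    using tf that unfolding triangle_free_def by blast
  have deg2: "deg S v \<ge> 2" if "v \<in> S" for v
    using low that unfolding low_def by force
  \<comment> \<open>The vertices outside both neighbourhoods: at most one.\<close>
  define Z where "Z = S - (nbrs S x \<union> nbrs S y)"
  have "card Z + card (nbrs S x \<union> nbrs S y) = card S"
    unfolding Z_def using fin by (intro card_Diff_sub) (auto simp: nbrs_def)
  then have "card Z \<le> 1"
    using neg triangle_free_degree_sum[OF fin tf xy] by linarith
  then have Z: "s = t" if "s \<in> Z" "t \<in> Z" for s t
    using that fin by (metis One_nat_def Z_def card_le_Suc0_iff_eq finite_Diff)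
  have toZ: "\<exists>z \<in> Z. adj v z" if st: "s \<in> S" "t \<in> S" "adj s t" "v \<in> nbrs S t - {s}" "Z = S - (nbrs S s \<union> nbrs S t)"
    for s t v
  proof -
    have v: "v \<in> S" "adj v t" "v \<noteq> s" using st adj_sym by (auto simp: nbrs_def)
    then have "\<not> adj v s" using no_tri[of v s t] st by blast
    then obtain z where z: "z \<in> S" "adj v z" "\<not> adj s z"
      using undom[of v s] v st by (auto simp: nbrs_def)
    then have "\<not> adj t z" using no_tri[of v t z] v st by blast
    then show ?thesis using z st(5) by (auto simp: nbrs_def)
  qed
  have small_deg: "deg S t \<le> 2" if st: "s \<in> S" "t \<in> S" "adj s t" "Z = S - (nbrs S s \<union> nbrs S t)" for s t
  proof (rule ccontr)
    assume "\<not> ?thesis"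
    then have "card (nbrs S t - {s}) \<ge> 2"
      using fin by (simp add: deg_def card_Diff_singleton_if) linarith
    then obtain v v' where v: "v \<in> nbrs S t - {s}" "v' \<in> nbrs S t - {s}" "v \<noteq> v'"
      using fin by (metis One_nat_def Suc_1 card_le_Suc0_iff_eq finite_Diff finite_nbrs not_less_eq_eq)
    obtain z where z: "z \<in> Z" "adj v z" using toZ[OF st(1-3) v(1) st(4)] by blast
    obtain z' where z': "z' \<in> Z" "adj v' z'" using toZ[OF st(1-3) v(2) st(4)] by blast
    have zz: "z' = z" using Z z z' by blast
    have zS: "z \<in> S" using z by (simp add: Z_def)
    have vS: "v \<in> S" "v' \<in> S" "adj t v" "adj t v'" using v by (auto simp: nbrs_def)
    have "\<not> adj v v'" using no_tri[of t v v'] vS st by blast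
    moreover have "nbrs S v \<subseteq> nbrs S v'"
    proof
      fix w assume "w \<in> nbrs S v"
      then have w: "w \<in> S" "adj v w" by (auto simp: nbrs_def)
      have "w \<in> {t, z}"
      proof (rule ccontr)
        assume nw: "w \<notin> {t, z}"
        then have "w \<notin> Z" using Z z by blast
        then have "adj s w \<or> adj t w" using w st(4) by (auto simp: nbrs_def)
        moreover have "\<not> adj t w" using no_tri[of t v w] vS w st by blast
        ultimately have "w \<in> nbrs S s - {t}" using w nw by (auto simp: nbrs_def)
        moreover have "Z = S - (nbrs S t \<union> nbrs S s)" using st(4) by (simp add: Un_commute)
        ultimately obtain z'' where "z'' \<in> Z" "adj w z''"
          using toZ[OF st(2,1) adj_sym[OF st(3)]] by blast
        then have "adj w z" using Z z by blast
        then show False using no_tri[of v w z] vS w z zS by blast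
      qed
      then show "w \<in> nbrs S v'"
        using z' zz zS vS st adj_sym by (auto simp: nbrs_def)
    qed
    ultimately show False using undom vS v(3) by blast
  qed
  have "deg S y \<le> 2" by (rule small_deg[OF xy]) (simp add: Z_def)
  moreover have "deg S x \<le> 2"
    by (rule small_deg[OF xy(2,1) adj_sym[OF xy(3)]]) (simp add: Z_def Un_commute)
  ultimately show False using neg n by linarith
qed

lemma edges_remove_edge:
  assumes fin: "finite S" and tf: "triangle_free S" and xy: "x \<in> S" "y \<in> S" "adj x y"
  shows "card (edges (S - {x, y})) + card {v \<in> S - {x, y}. adj x v \<or> adj y v} + 1
           \<le> card (edges S)"
proof -
  let ?H = "S - {x, y}" and ?D = "{v \<in> S - {x, y}. adj x v \<or> adj y v}"
  define g where "g v = (if adj x v then {x, v} else {y, v})" for v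
  have inj: "inj_on g ?D"
    by (auto simp: inj_on_def g_def doubleton_eq_iff split: if_splits)
  have new: "g v \<in> edges S - edges ?H - {{x, y}}" if "v \<in> ?D" for v
    using that xy by (auto simp: g_def doubleton_in_edges doubleton_eq_iff)
  have "edges ?H \<union> g ` ?D \<union> {{x, y}} \<subseteq> edges S"
    using new edges_mono[of ?H S] xy by (auto simp: doubleton_in_edges)
  then have "card (edges ?H \<union> g ` ?D \<union> {{x, y}}) \<le> card (edges S)"
    using fin by (intro card_mono) auto
  moreover have "card (edges ?H \<union> g ` ?D \<union> {{x, y}}) = card (edges ?H \<union> g ` ?D) + card {{x, y}}"
    using fin new by (intro card_Un_disjoint) (auto simp: doubleton_in_edges)
  moreover have "card (edges ?H \<union> g ` ?D) = card (edges ?H) + card (g ` ?D)"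
    using fin new by (intro card_Un_disjoint) auto
  ultimately show ?thesis using card_image[OF inj] by simp
qed

text \<open>
  With minimum degree two, a single edge \<open>xy\<close> serves as the big clique. The label of
  an edge between \<open>{x, y}\<close> and the rest becomes the private label of its outer end,
  and the label of \<open>xy\<close> itself is saved. Since the number of edges is at most
  $n(n-2)/4$, this one label is exactly what is needed. A vertex of degree one can be undominated
  only as part of an isolated edge; then there are two vertices of low degree, and the graph is
  sparse.
\<close>

lemma small_if_undominated:
  assumes fin: "finite S" and n: "card S \<ge> 14" and tf: "triangle_free S"
    and undom: "\<And>u v. u \<in> S \<Longrightarrow> v \<in> S \<Longrightarrow> u \<noteq> v \<Longrightarrow> \<not> adj u v \<Longrightarrow> \<not> nbrs S u \<subseteq> nbrs S v"
  shows "small S"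
proof (cases "low S = {}")
  case False
  then obtain u where u: "u \<in> S" "deg S u \<le> 1" by (auto simp: low_def)
  have "nbrs S u \<noteq> {}"
  proof
    assume e: "nbrs S u = {}"
    obtain v where "v \<in> S" "v \<noteq> u"
      using n fin by (metis One_nat_def card_le_Suc0_iff_eq le_trans not_less_eq_eq numeral_le_one_iff semiring_norm(69) u(1))
    then show False using undom[of u v] u e by (auto simp: nbrs_def)
  qed
  then obtain w where w: "nbrs S u = {w}"
    using u(2) fin unfolding deg_def
    by (metis One_nat_def card_le_Suc0_iff_eq finite_nbrs is_singletonI' is_singleton_the_elem)
  have uw: "w \<in> S" "adj u w" "u \<noteq> w" using w adj_irrefl by (auto simp: nbrs_def)
  have "nbrs S w \<subseteq> {u}"
  proof
    fix z assume z: "z \<in> nbrs S w"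
    show "z \<in> {u}"
    proof (rule ccontr)
      assume "z \<notin> {u}"
      moreover have "z \<in> S" "adj w z" "z \<noteq> w" using z adj_irrefl by (auto simp: nbrs_def)
      moreover have "\<not> adj u z" using calculation w by (auto simp: nbrs_def)
      moreover have "nbrs S u \<subseteq> nbrs S z" using w calculation uw adj_sym by (auto simp: nbrs_def)
      ultimately show False using undom[of u z] u by blast
    qed
  qed
  then have "deg S w \<le> 1" using card_mono[of "{u}" "nbrs S w"] by (simp add: deg_def)
  then have "{u, w} \<subseteq> low S" using u uw by (simp add: low_def)
  then have l2: "card (low S) \<ge> 2"
    using uw(3) fin card_mono[of "low S" "{u, w}"] by (simp add: low_def)
  define l p where "l = card (low S)" and "p = card S - l"
  have np: "card S = p + l" using card_low_le[OF fin] by (simp add: p_def l_def)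
  have "4 * card (ecover S) \<le> p\<^sup>2 + 4 * l"
    using triangle_free_ecover_le[OF fin tf] by (simp add: p_def l_def)
  moreover have "10 * l + 2 * p + 4 \<le> 2 * (p * l) + l * l"
  proof -
    have "2 \<le> l" using l2 by (simp add: l_def)
    moreover have "14 * l \<le> (p + l) * l" using n np by (intro mult_right_mono) auto
    then have "14 * l \<le> p * l + l * l" by (simp only: add_mult_distrib)
    moreover have "2 * p \<le> p * l" using \<open>2 \<le> l\<close> by simp
    ultimately show ?thesis by linarith
  qed
  ultimately have "4 * (card (ecover S) + l) + 2 * card S + 4 \<le> (card S)\<^sup>2"
    unfolding np by (simp add: power2_eq_square algebra_simps)
  then show ?thesis
    using representable_ecover[OF fin] unfolding small_def l_def by blast
next
  case True
  have no_tri: False if "a \<in> S" "b \<in> S" "c \<in> S" "adj a b" "adj b c" "adj a c" for a b c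
    using tf that unfolding triangle_free_def by blast
  have other: "\<exists>w \<in> S. adj v w \<and> w \<noteq> x" if "v \<in> S" for v x
    using not_low_obtains[of S v x] fin True that by blast
  have edge_bound: "4 * card (edges S) \<le> (card S - 2) * card S"
  proof (rule edges_le_of_degree_sum[OF fin])
    fix u v assume "u \<in> S" "v \<in> S" "adj u v"
    then have "deg S u + deg S v + 2 \<le> card S"
      using n by (intro undominated_degree_sum[OF fin _ tf True undom]) auto
    then show "deg S u + deg S v \<le> card S - 2" by simp
  qed
  obtain x where x: "x \<in> S" using n by fastforce
  then obtain y where y: "y \<in> S" "adj x y" using other by blast
  let ?Q = "{x, y}"
  let ?D = "{v \<in> S - ?Q. adj x v \<or> adj y v}"
  have count: "card (edges (S - ?Q)) + card ?D + 1 \<le> card (edges S)"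
    by (rule edges_remove_edge[OF fin tf x y])
  have edge_avoiding: "\<exists>c \<in> edges (S - ?Q). v \<in> c \<and> w \<notin> c"
    if v: "v \<in> S - ?Q" "\<not> adj x v" "\<not> adj y v" "v \<noteq> w" for v w
  proof -
    obtain z where z: "z \<in> S" "adj v z" "z \<noteq> w" using other v by blast
    then have "{v, z} \<in> edges (S - ?Q)" using v adj_sym by (auto simp: doubleton_in_edges)
    then show ?thesis using z v by (intro bexI[of _ "{v, z}"]) auto
  qed
  have nonisolated: "nbrs (S - ?Q) v \<noteq> {}" if v: "v \<in> S - ?Q" for v
  proof -
    obtain z where z: "z \<in> S" "adj v z" "z \<noteq> x" using other v by blast
    obtain z' where z': "z' \<in> S" "adj v z'" "z' \<noteq> y" using other v by blast
    have "z \<noteq> y \<or> z' \<noteq> x" using no_tri[of v x y] z z' x y v by blast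
    then show ?thesis using z z' by (auto simp: nbrs_def)
  qed
  then have ec: "ecover (S - ?Q) = edges (S - ?Q)" by (auto simp: ecover_def)
  \<comment> \<open>The private label of \<open>w\<close> lies in the set of \<open>q\<close> but not in that of \<open>p\<close> or of \<open>v\<close>.\<close>
  have third: "\<exists>w \<in> ?D. w \<noteq> v \<and> adj p w \<and> \<not> adj q w"
    if pq: "p \<in> ?Q" "q \<in> ?Q" "p \<noteq> q" and v: "v \<in> ?Q \<or> adj q v" for p q v
  proof -
    have "p \<in> S" "q \<in> S" "adj p q" using pq x y adj_sym by auto
    moreover obtain w where w: "w \<in> S" "adj p w" "w \<noteq> q" using other \<open>p \<in> S\<close> by blast
    ultimately have "\<not> adj q w" using no_tri[of p q w] by blast
    moreover have "w \<in> ?D" using w pq adj_irrefl by auto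
    ultimately show ?thesis using w v by auto
  qed
  have "representable S (card (edges (S - ?Q)) + card ?D + card ({} :: 'a set set))"
  proof (rule representable_big_clique[OF fin, of ?Q])
    show "clique_cover (S - ?Q) (edges (S - ?Q))" "\<Union>(edges (S - ?Q)) = S - ?Q"
      using clique_cover_ecover[of "S - ?Q"] fin ec by auto
    show "edges (S - ?Q) \<noteq> {}"
    proof -
      obtain w where w: "w \<in> S - ?Q" using third[of x y x] adj_neq[OF y(2)] by auto
      then obtain z where "z \<in> S - ?Q" "adj w z" using nonisolated[OF w] by (auto simp: nbrs_def)
      then show ?thesis using w doubleton_in_edges[of w z] by blast
    qed
    show "\<exists>c \<in> edges (S - ?Q). v \<in> c \<and> w \<notin> c"
      if "v \<in> S - ?Q - ?D" "w \<in> S - ?Q" "adj v w" for v w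
      using edge_avoiding[of v w] that adj_neq[of v w] by blast
    show "(\<exists>r \<in> {}. p \<in> r \<and> q \<notin> r) \<or> (\<exists>v \<in> ?D. adj q v \<and> \<not> adj p v)"
      if "p \<in> ?Q" "q \<in> ?Q" "p \<noteq> q" for p q
      using third[of q p x] that by auto
    show "(\<exists>c \<in> edges (S - ?Q). v \<notin> c) \<or> (\<exists>w \<in> ?D. w \<noteq> v \<and> \<not> adj q w)"
      if "v \<in> S - ?Q" "q \<in> ?Q" "adj q v" for v q
    proof -
      obtain p where "p \<in> ?Q" "p \<noteq> q" using that adj_neq[OF y(2)] by auto
      then show ?thesis using third[of p q v] that by auto
    qed
  qed (use x y adj_sym in \<open>auto simp: clique_def\<close>)
  then have "representable S (card (edges (S - ?Q)) + card ?D)" by simp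
  moreover have "4 * (card (edges (S - ?Q)) + card ?D) + 2 * card S + 4 \<le> (card S)\<^sup>2"
  proof -
    obtain k where k: "card S = k + 2" using n by (intro that[of "card S - 2"]) simp
    have "4 * card (edges S) \<le> k * (k + 2)" using edge_bound k by simp
    moreover have "(card S)\<^sup>2 = k * (k + 2) + 2 * card S" using k by (simp add: power2_eq_square)
    moreover have "4 * (card (edges (S - ?Q)) + card ?D) + 4 \<le> 4 * card (edges S)"
      using count by simp
    ultimately show ?thesis by simp
  qed
  ultimately show ?thesis unfolding small_def by blast
qed

theorem small_if_triangle_free:
  assumes "finite S" "card S \<ge> 14" "triangle_free S"
  shows "small S"
  using small_if_dominated[OF assms] small_if_undominated[OF assms] by blast

section \<open>Graphs with a triangle\<close>

lemma not_triangle_free_obtains: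
  assumes "\<not> triangle_free S"
  obtains P where "P \<subseteq> S" "clique P" "card P = 3"
proof -
  obtain a b c where abc: "{a, b, c} \<subseteq> S" "adj a b" "adj b c" "adj a c"
    using assms unfolding triangle_free_def by blast
  then have "clique {a, b, c}" "card {a, b, c} = 3"
    using adj_sym adj_neq unfolding clique_def by (auto simp: card_insert_if)
  then show thesis using that abc(1) by blast
qed

lemma card_ecover_star:
  assumes fin: "finite H" and v: "v \<in> H" "\<And>c. c \<in> ecover H \<Longrightarrow> v \<in> c"
  shows "card (ecover H) \<le> card H"
proof -
  have "ecover H \<subseteq> (\<lambda>w. {v, w}) ` H"
  proof
    fix c assume c: "c \<in> ecover H"
    then have vc: "v \<in> c" by (rule v(2))
    from c have "c \<in> edges H \<or> (\<exists>w \<in> H. c = {w})" by (auto simp: ecover_def)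
    then show "c \<in> (\<lambda>w. {v, w}) ` H"
    proof
      assume "c \<in> edges H"
      then obtain s t where "c = {s, t}" "s \<in> H" "t \<in> H" by (auto simp: edges_def)
      then show ?thesis using vc by (auto simp: insert_commute)
    next
      assume "\<exists>w \<in> H. c = {w}"
      then show ?thesis using vc by auto
    qed
  qed
  then show ?thesis using fin by (meson card_image_le card_mono finite_imageI le_trans)
qed

lemma clique_if_common_neighbour:
  assumes "clique Q" "\<And>q. q \<in> Q \<Longrightarrow> adj q v"
  shows "clique (insert v Q)"
  using assms adj_sym unfolding clique_def by blast

text \<open>
  With the edges outside \<open>Q\<close> as cliques and a private label for every outside vertex,
  only two labels remain for separating the three big sets. Two suffice: some outside vertex
  \<open>v\<close> is adjacent to one vertex \<open>y\<close> of \<open>Q\<close> but not to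
  another one \<open>x\<close>, and its private label already does part of the work. If there is
  no such \<open>v\<close>, then \<open>Q\<close> is an isolated triangle, and no private labels
  are needed for it. The case of a vertex common to all cliques, where a big set might be
  swallowed, is that of a star outside \<open>Q\<close>.
\<close>

lemma small_if_sparse_outside_triangle:
  assumes fin: "finite S" and n: "card S \<ge> 14"
    and Q: "Q \<subseteq> S" "clique Q" "card Q = 3"
    and no_K4: "\<And>K. K \<subseteq> S \<Longrightarrow> clique K \<Longrightarrow> card K \<noteq> 4"
    and tf: "triangle_free (S - Q)"
    and sparse: "4 * card (edges (S - Q)) + 9 \<le> (card (S - Q))\<^sup>2"
  shows "small S"
proof -
  define H where "H = S - Q"
  define m l p where "m = card H" and "l = card (low H)" and "p = m - l"
  have finH: "finite H" using fin by (simp add: H_def)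
  have finQ: "finite Q" using Q(1) fin finite_subset by blast
  have m: "card S = m + 3" "m \<ge> 11"
    using card_Diff_sub[OF fin Q(1)] Q(3) n by (simp_all add: H_def m_def)
  have mp: "m = p + l" using card_low_le[OF finH] by (simp add: m_def l_def p_def)
  have ml: "11 * l \<le> p * l + l * l"
    using mult_right_mono[OF m(2), of l] unfolding mp by (simp add: add_mult_distrib)
  have cover: "4 * card (ecover H) \<le> p\<^sup>2 + 4 * l"
    using triangle_free_ecover_le[OF finH] tf by (simp add: m_def l_def p_def H_def)
  have sparse': "4 * card (ecover H) + 9 \<le> m\<^sup>2"
  proof (cases "l = 0")
    case True
    then have "low H = {}" using finH by (simp add: l_def low_def)
    then show ?thesis using ecover_eq_edges[OF finH] sparse by (simp add: m_def H_def)
  next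
    case False
    have "4 * l + 9 \<le> 2 * (p * l) + l * l"
    proof (cases "l = 1")
      case True
      then show ?thesis using mp m(2) by simp
    next
      case F: False
      then show ?thesis using ml False by linarith
    qed
    then show ?thesis using cover unfolding mp by (simp add: power2_eq_square algebra_simps)
  qed
  note C = clique_cover_ecover[OF finH]
  have H_ne: "ecover H \<noteq> {}"
  proof
    assume "ecover H = {}"
    then have "H = {}" using C(2) by simp
    then show False using m(2) by (simp add: m_def)
  qed
  have no_common: "\<exists>q \<in> Q. \<not> adj q v" if v: "v \<in> H" for v
  proof (rule ccontr)
    assume "\<not> ?thesis"
    then have "clique (insert v Q)" using Q(2) clique_if_common_neighbour by blast
    moreover have "insert v Q \<subseteq> S" "card (insert v Q) = 4"
      using v Q finQ by (auto simp: H_def)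
    ultimately show False using no_K4 by blast
  qed
  consider (star) v where "v \<in> H" "\<And>c. c \<in> ecover H \<Longrightarrow> v \<in> c"
    | (isolated) "\<And>q v. q \<in> Q \<Longrightarrow> v \<in> H \<Longrightarrow> \<not> adj q v"
    | (main) x y v where "x \<in> Q" "y \<in> Q" "v \<in> H" "\<not> adj x v" "adj y v"
        "\<And>v. v \<in> H \<Longrightarrow> \<exists>c \<in> ecover H. v \<notin> c"
    using no_common by metis
  then show ?thesis
  proof cases
    case star
    have rep: "representable S (card (ecover H) + 2 + card S)"
      using representable_clique_cover[OF fin Q(1,2)] C m(2) unfolding H_def m_def by simp
    have "card (ecover H) \<le> m"
      unfolding m_def by (rule card_ecover_star[OF finH star])
    moreover obtain d where "m = 11 + d" using m(2) le_Suc_ex by blast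
    ultimately have "4 * (card (ecover H) + 2 + card S) + 2 * card S + 4 \<le> (card S)\<^sup>2"
      using m(1) by (simp add: power2_eq_square algebra_simps)
    then show ?thesis using rep unfolding small_def by blast
  next
    case isolated
    \<comment> \<open>Nothing outside sees \<open>Q\<close>, so private labels go only to vertices of low degree.\<close>
    have "representable S (card (ecover H) + card (low H) + card ((\<lambda>q. {q}) ` Q))"
    proof (rule representable_big_clique[OF fin Q(1,2)])
      show "clique_cover (S - Q) (ecover H)" "\<Union>(ecover H) = S - Q"
        using C by (simp_all add: H_def)
      show "\<exists>c \<in> ecover H. v \<in> c \<and> w \<notin> c"
        if vw: "v \<in> S - Q - low H" "w \<in> S - Q" "adj v w" for v w
      proof -
        obtain x where x: "x \<in> H" "adj v x" "x \<noteq> w"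
          using not_low_obtains[OF finH, of v w] vw by (auto simp: H_def)
        then have "{v, x} \<in> ecover H"
          using vw by (simp add: ecover_def doubleton_in_edges H_def)
        then show ?thesis
          using x adj_neq[OF vw(3)] by (intro bexI[of _ "{v, x}"]) auto
      qed
    qed (use finQ H_ne isolated in \<open>auto simp: low_def H_def\<close>)
    moreover have "card ((\<lambda>q. {q}) ` Q) = 3" using Q(3) by (simp add: card_image)
    ultimately have "representable S (card (ecover H) + l + 3)" by (simp add: l_def)
    moreover have "4 * (card (ecover H) + l + 3) + 2 * card S + 4 \<le> (card S)\<^sup>2"
    proof -
      have "13 + 4 * l \<le> 2 * (p * l) + l * l + 4 * p"
        using ml m(2) mp by linarith
      then show ?thesis
        using cover unfolding m(1) mp by (simp add: power2_eq_square algebra_simps)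
    qed
    ultimately show ?thesis unfolding small_def by blast
  next
    case main
    have "x \<noteq> y" using main by auto
    then have "card (Q - {x, y}) = 1"
      using main(1,2) Q(3) finQ card_Diff_subset[of "{x, y}" Q] by simp
    then obtain z where "Q - {x, y} = {z}" by (auto simp: card_1_singleton_iff)
    then have Qxyz: "Q = {x, y, z}" "z \<noteq> x" "z \<noteq> y" using main(1,2) by auto
    \<comment> \<open>If \<open>z\<close> sees \<open>v\<close>, then \<open>Own v\<close> lies in the set of \<open>x\<close> only; otherwise in those of \<open>x\<close> and \<open>z\<close>.\<close>
    define R where "R = (if adj z v then {{y}, {z}} else {{x, y}, {y, z}})"
    have "representable S (card (ecover H) + card H + card R)"
    proof (rule representable_big_clique[OF fin Q(1,2)])
      show "clique_cover (S - Q) (ecover H)" "\<Union>(ecover H) = S - Q"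
        using C by (simp_all add: H_def)
      show "(\<exists>r \<in> R. p \<in> r \<and> q \<notin> r) \<or> (\<exists>v \<in> H. adj q v \<and> \<not> adj p v)"
        if "p \<in> Q" "q \<in> Q" "p \<noteq> q" for p q
        using that main(3-5) \<open>x \<noteq> y\<close> Qxyz unfolding R_def by (cases "adj z v") auto
      show "(\<exists>c \<in> ecover H. v \<notin> c) \<or> (\<exists>w \<in> H. w \<noteq> v \<and> \<not> adj q w)" if "v \<in> S - Q" for v q
        using main(6) that by (simp add: H_def)
    qed (use H_ne in \<open>auto simp: H_def R_def\<close>)
    moreover have "card R \<le> 2"
      using card_length[of "[{y}, {z}]"] card_length[of "[{x, y}, {y, z}]"] by (simp add: R_def)
    ultimately have "representable S (card (ecover H) + m + 2)"
      by (elim representable_mono) (simp add: m_def)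
    moreover have "4 * (card (ecover H) + m + 2) + 2 * card S + 4 \<le> (card S)\<^sup>2"
      using sparse' unfolding m(1) by (simp add: power2_eq_square algebra_simps)
    ultimately show ?thesis unfolding small_def by blast
  qed
qed

text \<open>
  The vertices of \<open>A\<close> are told apart by their adjacency to a single vertex of
  \<open>Q\<close>.
\<close>

lemma card_le_of_types:
  assumes A: "finite A" and R: "finite R" "card R \<le> 1"
    and touch: "\<And>a q. a \<in> A \<Longrightarrow> q \<in> Q \<Longrightarrow> adj a q \<Longrightarrow> q \<in> R"
    and inj: "\<And>a b. a \<in> A \<Longrightarrow> b \<in> A \<Longrightarrow> (\<forall>q \<in> Q. adj a q \<longleftrightarrow> adj b q) \<Longrightarrow> a = b"
  shows "card A \<le> 2"
proof -
  have "inj_on (\<lambda>a. {q \<in> Q. adj a q}) A"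
    by (rule inj_onI) (use inj in blast)
  moreover have "(\<lambda>a. {q \<in> Q. adj a q}) ` A \<subseteq> Pow R" using touch by auto
  ultimately have "card A \<le> card (Pow R)" using R(1) by (intro card_inj_on_le) auto
  also have "\<dots> \<le> 2 ^ 1" unfolding card_Pow[OF R(1)] using R(2) by (rule power_increasing) simp
  finally show ?thesis by simp
qed

text \<open>
  Let \<open>X\<close> and \<open>Y\<close> be the sides of the almost complete bipartite graph
  outside \<open>Q\<close>, and call a vertex full if it is adjacent to the entire other side.
  Full vertices of one side are told apart by \<open>Q\<close> alone. If no vertex of
  \<open>Q\<close> saw full vertices on both sides, then one side would see at most one vertex of
  \<open>Q\<close> and would have at most two full vertices, but each side has three. So some
  \<open>x \<in> Q\<close> forms a triangle with full vertices \<open>a \<in> X\<close> and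
  \<open>b \<in> Y\<close>. Let \<open>y\<close> and \<open>z\<close> be the other vertices of
  \<open>Q\<close>, and let \<open>t\<close> be one of them. All triangles meet \<open>{x, a,
  b}\<close>, hence \<open>t\<close> sees further full vertices on one side only, no further
  vertex sees both \<open>y\<close> and \<open>z\<close>, and the full vertices seen by
  \<open>t\<close> are told apart by \<open>x\<close> alone: there are at most two. Exchanging
  \<open>a, b\<close> for \<open>y, z\<close> in the outside therefore loses edges.
\<close>

lemma small_if_triangle:
  assumes fin: "finite S" and n: "card S \<ge> 14"
    and Q: "Q \<subseteq> S" "clique Q" "card Q = 3"
  shows "small S"
proof (rule ccontr)
  assume not_small: "\<not> small S"
  have no_K4: "card K \<noteq> 4" if "K \<subseteq> S" "clique K" for K
    using small_if_K4[OF fin n that] not_small by blast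
  have outside: "triangle_free (S - P)" if P: "P \<subseteq> S" "clique P" "card P = 3" for P
  proof (rule ccontr)
    assume "\<not> triangle_free (S - P)"
    then obtain P' where "P' \<subseteq> S - P" "clique P'" "card P' = 3"
      by (rule not_triangle_free_obtains)
    then show False using small_if_disjoint_triangles[OF fin n P] not_small by blast
  qed
  have no_twins: "u = v" if uv: "u \<in> S - Q" "v \<in> S" "nbrs S u = nbrs S v" for u v
  proof (rule ccontr)
    assume "u \<noteq> v"
    then show False
      using small_if_twins_and_triangle[OF fin n _ uv(2) _ uv(3) _ Q(2,3)] uv Q(1) not_small by blast
  qed
  define H where "H = S - Q"
  have finH: "finite H" using fin by (simp add: H_def)
  have finQ: "finite Q" using Q(1) fin finite_subset by blast
  have tfH: "triangle_free H" using outside[OF Q] by (simp add: H_def)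
  have cardH: "card H + 3 = card S" "card H \<ge> 11"
    using card_Diff_sub[OF fin Q(1)] Q(3) n by (simp_all add: H_def)
  have dense: "(card (S - P))\<^sup>2 \<le> 4 * card (edges (S - P)) + 8"
    if P: "P \<subseteq> S" "clique P" "card P = 3" for P
    using small_if_sparse_outside_triangle[OF fin n P no_K4 outside[OF P]] not_small by linarith
  have nine: "card H \<ge> 9" using cardH by simp
  obtain X Y where XY: "H = X \<union> Y" "X \<inter> Y = {}"
    and X: "\<And>u v. u \<in> X \<Longrightarrow> v \<in> X \<Longrightarrow> \<not> adj u v"
    and Y: "\<And>u v. u \<in> Y \<Longrightarrow> v \<in> Y \<Longrightarrow> \<not> adj u v"
    and missing: "card {p \<in> X \<times> Y. \<not> adj (fst p) (snd p)} \<le> 2"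
    and big: "card H \<le> 2 * card X + 2" "card H \<le> 2 * card Y + 2"
    by (rule almost_complete_bipartite[OF finH tfH nine dense[OF Q, folded H_def]]) (rule that)
  have finXY: "finite X" "finite Y" using finH by (simp_all add: XY(1))
  define X' Y' where "X' = {a \<in> X. \<forall>b \<in> Y. adj a b}" and "Y' = {b \<in> Y. \<forall>a \<in> X. adj b a}"
  have "X - X' = {a \<in> X. \<exists>b \<in> Y. \<not> adj a b}" "Y - Y' = {b \<in> Y. \<exists>a \<in> X. \<not> adj b a}"
    by (auto simp: X'_def Y'_def)
  then have nonfull: "card (X - X') \<le> 2" "card (Y - Y') \<le> 2"
    using nonfull_le_missing[OF finXY] missing by simp_all
  have finX': "finite X'" "finite Y'" using finXY by (simp_all add: X'_def Y'_def)
  have "card (X - X') + card X' = card X" "card (Y - Y') + card Y' = card Y"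
    using finXY by (intro card_Diff_sub; auto simp: X'_def Y'_def)+
  then have three: "card X' \<ge> 3" "card Y' \<ge> 3"
    using nonfull big cardH(2) by linarith+
  have S: "S = X \<union> Y \<union> Q" using XY(1) Q(1) by (auto simp: H_def)
  have types: "u = v" if uv: "u \<in> X' \<and> v \<in> X' \<or> u \<in> Y' \<and> v \<in> Y'"
      and same: "\<forall>q \<in> Q. adj u q \<longleftrightarrow> adj v q" for u v
  proof (rule no_twins)
    show "u \<in> S - Q" using uv XY(1) by (auto simp: X'_def Y'_def H_def)
    show "v \<in> S" using uv by (auto simp: X'_def Y'_def S)
    show "nbrs S u = nbrs S v"
      using uv same X Y unfolding nbrs_def S X'_def Y'_def by auto
  qed
  have "\<exists>q \<in> Q. \<exists>a \<in> X'. \<exists>b \<in> Y'. adj q a \<and> adj q b"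
  proof (rule ccontr)
    assume none: "\<not> ?thesis"
    \<comment> \<open>The vertices of \<open>Q\<close> seen from the full part of each side; disjoint by assumption.\<close>
    define TX TY where "TX = {q \<in> Q. \<exists>a \<in> X'. adj a q}" and "TY = {q \<in> Q. \<exists>b \<in> Y'. adj b q}"
    have fin': "finite TX" "finite TY" using finQ by (simp_all add: TX_def TY_def)
    have "TX \<inter> TY = {}" using none adj_sym unfolding TX_def TY_def by blast
    then have "card TX + card TY = card (TX \<union> TY)" using card_Un_disjoint[OF fin'] by simp
    also have "\<dots> \<le> card Q" using finQ by (intro card_mono) (auto simp: TX_def TY_def)
    finally have "card TX \<le> 1 \<or> card TY \<le> 1" using Q(3) by linarith
    then show False
    proof
      assume "card TX \<le> 1"
      have "card X' \<le> 2"
        by (rule card_le_of_types[OF finX'(1) fin'(1) \<open>card TX \<le> 1\<close>, where Q = Q])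
          (use types in \<open>auto simp: TX_def\<close>)
      then show False using three by simp
    next
      assume "card TY \<le> 1"
      have "card Y' \<le> 2"
        by (rule card_le_of_types[OF finX'(2) fin'(2) \<open>card TY \<le> 1\<close>, where Q = Q])
          (use types in \<open>auto simp: TY_def\<close>)
      then show False using three by simp
    qed
  qed
  then obtain x a b where x: "x \<in> Q" and ab: "a \<in> X'" "b \<in> Y'" "adj x a" "adj x b" by blast
  have abXY: "a \<in> X" "b \<in> Y" "adj a b" "a \<notin> Q" "b \<notin> Q" "a \<noteq> b"
    using ab XY by (auto simp: X'_def Y'_def H_def)
  have "card (Q - {x}) = 2" using x Q(3) finQ by simp
  then obtain y z where "Q - {x} = {y, z}" "y \<noteq> z" by (auto simp: card_2_iff)
  then have Qxyz: "Q = {x, y, z}" "y \<noteq> z" "y \<noteq> x" "z \<noteq> x" using x by auto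
  have yz: "adj y z" using Q(2) Qxyz by (simp add: clique_def)
  let ?P = "{x, a, b}"
  have P: "?P \<subseteq> S" "clique ?P" "card ?P = 3"
    using x ab abXY S adj_sym by (auto simp: clique_def card_insert_if)
  have no_tri: False
    if "{s, t, u} \<subseteq> S" "{s, t, u} \<inter> ?P = {}" "adj s t" "adj t u" "adj s u" for s t u
    using outside[OF P] that unfolding triangle_free_def by blast
  define H' where "H' = H - {a, b}"
  have H': "H' \<subseteq> S - Q" by (auto simp: H'_def H_def)
  have one: "\<not> (adj y w \<and> adj z w)" if "w \<in> H'" for w
  proof
    assume "adj y w \<and> adj z w"
    moreover have "w \<in> S" "w \<notin> Q" "w \<noteq> a" "w \<noteq> b" using that by (auto simp: H'_def H_def)
    ultimately show False
      using no_tri[of y z w] yz Qxyz abXY S by auto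
  qed
  define W where "W t = {w \<in> X' \<union> Y' - {a, b}. adj t w}" for t
  have finW: "finite (W t)" for t using finX' by (simp add: W_def)
  have W: "card (W t) \<le> 2" if t: "t \<in> {y, z}" for t
  proof -
    have tQ: "t \<in> S" "t \<notin> ?P" using t S Qxyz abXY by auto
    \<comment> \<open>Both elements see \<open>t\<close>, so neither sees the third vertex of \<open>Q\<close>, and only \<open>x\<close> can tell them apart.\<close>
    have "inj_on (\<lambda>w. adj x w) (W t)"
    proof (rule inj_onI)
      fix u v assume uv: "u \<in> W t" "v \<in> W t" "adj x u = adj x v"
      have full: "u \<in> X' \<union> Y'" "v \<in> X' \<union> Y'" "adj t u" "adj t v"
        "{u, v} \<inter> {a, b} = {}" using uv by (auto simp: W_def)
      have H'uv: "u \<in> H'" "v \<in> H'"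
        using full XY(1) by (auto simp: H'_def X'_def Y'_def)
      have nQ: "u \<noteq> x" "v \<noteq> x" "u \<in> S" "v \<in> S" using H' H'uv x by auto
      have "\<not> adj u v"
        using no_tri[of t u v] full tQ nQ by auto
      then have "u \<in> X' \<and> v \<in> X' \<or> u \<in> Y' \<and> v \<in> Y'"
        using full by (auto simp: X'_def Y'_def)
      moreover have "adj u q \<longleftrightarrow> adj v q" if "q \<in> Q" for q
      proof -
        have "adj y u \<longleftrightarrow> adj y v" "adj z u \<longleftrightarrow> adj z v"
          using one[OF H'uv(1)] one[OF H'uv(2)] full t by auto
        then show ?thesis using that uv(3) adj_commute unfolding Qxyz(1) by blast
      qed
      ultimately show "u = v" using types by blast
    qed
    then have "card (W t) \<le> card (UNIV :: bool set)" by (intro card_inj_on_le) auto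
    then show ?thesis by simp
  qed
  \<comment> \<open>Each of these vertices contributes exactly one edge to \<open>y\<close> or \<open>z\<close>.\<close>
  define V where "V = {w \<in> H'. adj y w \<or> adj z w}"
  have finV: "finite V" using finH by (simp add: V_def H'_def)
  have "V \<subseteq> W y \<union> W z \<union> (X - X') \<union> (Y - Y')"
    by (auto simp: V_def W_def H'_def XY(1))
  then have "card V \<le> card (W y \<union> W z \<union> (X - X') \<union> (Y - Y'))"
    using finW finXY by (intro card_mono) auto
  also have "\<dots> \<le> card (W y) + card (W z) + card (X - X') + card (Y - Y')"
    by (meson add_mono_thms_linordered_semiring(1) card_Un_le le_trans order_refl)
  also have "\<dots> \<le> 4 + 2 * card {p \<in> X \<times> Y. \<not> adj (fst p) (snd p)}"
  proof -
    have "card (X - X') \<le> card {p \<in> X \<times> Y. \<not> adj (fst p) (snd p)}"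
         "card (Y - Y') \<le> card {p \<in> X \<times> Y. \<not> adj (fst p) (snd p)}"
      using nonfull_le_missing[OF finXY] \<open>X - X' = _\<close> \<open>Y - Y' = _\<close> by simp_all
    then show ?thesis using W[of y] W[of z] by simp
  qed
  finally have cardV: "card V \<le> 4 + 2 * card {p \<in> X \<times> Y. \<not> adj (fst p) (snd p)}" .
  have "edges (S - ?P) \<subseteq> edges H' \<union> {{y, z}} \<union> (\<lambda>w. {if adj y w then y else z, w}) ` V"
  proof
    fix e assume "e \<in> edges (S - ?P)"
    then obtain s t where st: "e = {s, t}" "s \<in> S - ?P" "t \<in> S - ?P" "adj s t"
      by (auto simp: edges_def)
    have S': "S - ?P = insert y (insert z H')"
      using S XY(1) Qxyz abXY by (auto simp: H'_def H_def)
    have g: "{q, w} \<in> (\<lambda>w. {if adj y w then y else z, w}) ` V"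
      if "q \<in> {y, z}" "w \<in> H'" "adj q w" for q w
      using that one[OF that(2)] by (intro image_eqI[of _ _ w]) (auto simp: V_def)
    show "e \<in> edges H' \<union> {{y, z}} \<union> (\<lambda>w. {if adj y w then y else z, w}) ` V"
    proof (cases "s \<in> H'")
      case True
      show ?thesis
      proof (cases "t \<in> H'")
        case True
        then show ?thesis using \<open>s \<in> H'\<close> st by (simp add: doubleton_in_edges)
      next
        case False
        then have "{t, s} \<in> (\<lambda>w. {if adj y w then y else z, w}) ` V"
          using True st S' adj_sym by (intro g) auto
        then show ?thesis using st(1) by (simp add: insert_commute)
      qed
    next
      case False
      show ?thesis
      proof (cases "t \<in> H'")
        case True
        then have "{s, t} \<in> (\<lambda>w. {if adj y w then y else z, w}) ` V"
          using False st S' by (intro g) auto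
        then show ?thesis using st(1) by simp
      next
        case F: False
        have "s \<in> {y, z}" "t \<in> {y, z}"
          using False F st(2,3) unfolding S' by auto
        then have "{s, t} = {y, z}" using adj_neq[OF st(4)] by auto
        then show ?thesis using st(1) by simp
      qed
    qed
  qed
  then have "card (edges (S - ?P)) \<le> card (edges H' \<union> {{y, z}} \<union> (\<lambda>w. {if adj y w then y else z, w}) ` V)"
    using finV finH by (intro card_mono) (auto simp: H'_def)
  also have "\<dots> \<le> card (edges H') + card {{y, z}} + card ((\<lambda>w. {if adj y w then y else z, w}) ` V)"
    by (meson add_mono_thms_linordered_semiring(1) card_Un_le le_trans order_refl)
  also have "\<dots> \<le> card (edges H') + 1 + card V"
    using card_image_le[OF finV] by simp
  finally have new_edges: "card (edges (S - ?P)) \<le> card (edges H') + 1 + card V" .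
  have H'XY: "H' = (X - {a}) \<union> (Y - {b})" using XY abXY by (auto simp: H'_def)
  \<comment> \<open>No pair is missing at the full vertices \<open>a\<close> and \<open>b\<close>.\<close>
  have "{p \<in> (X - {a}) \<times> (Y - {b}). \<not> adj (fst p) (snd p)} = {p \<in> X \<times> Y. \<not> adj (fst p) (snd p)}"
    using ab adj_commute by (auto simp: X'_def Y'_def)
  then have count: "card (edges H') + card {p \<in> X \<times> Y. \<not> adj (fst p) (snd p)} =
      card (X - {a}) * card (Y - {b})"
    using bipartite_edges[of "X - {a}" "Y - {b}"] finXY XY(2) X Y unfolding H'XY by auto
  define i j where "i = card (X - {a})" and "j = card (Y - {b})"
  have ij: "card X = i + 1" "card Y = j + 1"
    using card_Diff_sub[OF finXY(1), of "{a}"] card_Diff_sub[OF finXY(2), of "{b}"] abXY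
    by (simp_all add: i_def j_def)
  have cardXY: "card H = card X + card Y"
    unfolding XY(1) by (rule card_Un_disjoint[OF finXY XY(2)])
  have "card (S - ?P) = i + j + 2"
    using card_Diff_sub[OF fin P(1)] P(3) cardH(1) cardXY ij by simp
  then have "(i + j + 2)\<^sup>2 \<le> 4 * card (edges (S - ?P)) + 8"
    using dense[OF P] by simp
  also have "\<dots> \<le> 4 * (i * j + 7) + 8"
    using new_edges count cardV missing by (simp flip: i_def j_def)
  finally have "(i + j + 2)\<^sup>2 \<le> 4 * (i * j) + 36" by simp
  moreover have "4 * (i * j) \<le> (i + j)\<^sup>2"
  proof -
    have "int (4 * (i * j)) \<le> int ((i + j)\<^sup>2)"
      using zero_le_power2[of "int i - int j"] by (simp add: power2_eq_square algebra_simps)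
    then show ?thesis by (simp only: of_nat_le_iff)
  qed
  moreover have "i + j \<ge> 9" using cardH(2) cardXY ij by simp
  ultimately show False by (simp add: power2_eq_square algebra_simps)
qed

lemma small_graph:
  assumes "finite S" "card S \<ge> 14"
  shows "small S"
proof (cases "triangle_free S")
  case True
  then show ?thesis using small_if_triangle_free assms by blast
next
  case False
  then obtain P where "P \<subseteq> S" "clique P" "card P = 3" by (rule not_triangle_free_obtains)
  then show ?thesis by (rule small_if_triangle[OF assms])
qed

end

theorem theorem5p8:
  fixes G :: "'a pair_pre_digraph" and n :: nat
  assumes "pair_graph G"
    and "card (pverts G) = n"
    and "n \<ge> 14"
  shows "real (overlap_number G) \<le> (real n)\<^sup>2 / 4 - real n / 2 - 1"
proof -
  interpret G: pair_graph G by (rule assms(1))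
  interpret simple_graph "\<lambda>u v. (u, v) \<in> parcs G"
  proof
    show "(v, u) \<in> parcs G" if "(u, v) \<in> parcs G" for u v
      using that G.pair_sym_arcs by (auto simp: symmetric_def sym_def)
    show "(v, v) \<notin> parcs G" for v
      using G.pair_no_loops by force
  qed
  have fin: "finite (pverts G)" by (rule G.pair_finite_verts)
  have "small (pverts G)" using small_graph[OF fin] assms(2,3) by simp
  then obtain k where "representable (pverts G) k" and k: "4 * k + 2 * n + 4 \<le> n\<^sup>2"
    unfolding small_def assms(2) by blast
  then obtain f :: "'a \<Rightarrow> 'a label set"
    where "finite_overlap_representation G f" and "representation_size G f \<le> k"
    unfolding representable_def finite_overlap_representation_def overlap_representation_def
      representation_size_def by blast
  then have "overlap_number G \<le> k"
    using overlap_number_le[OF fin] le_trans by blast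
  then have "4 * overlap_number G + 2 * n + 4 \<le> n\<^sup>2" using k by linarith
  then have "real (4 * overlap_number G + 2 * n + 4) \<le> real (n\<^sup>2)" by (simp only: of_nat_le_iff)
  then show ?thesis by simp
qed

end
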